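(* Consider a market with a finite list of $m$ possible assets and a finite set $\mathcal X\subset[0,\infty)^m$ of feasible price relative vectors, and assume that there are at least three distinct price relative vectors in $\mathcal X$. The Bregman divergence $(P,Q)\mapsto W(\vec b_P,P)-W(\vec b_Q,P)$ on probability measures on $\mathcal X$ satisfies the sufficiency condition if and only if $W(\vec b_P,P)-W(\vec b_Q,P)=0$ implies $P=Q$ (for all probability measures $P,Q$ on $\mathcal X$).
   Context: A price relative vector $\vec X=(X_1,\dots,X_m)$ lists, for each of $m$ assets, the nonnegative factor by which the value of the asset is multiplied in one trading period. A portfolio is a probability vector $\vec b=(b_1,\dots,b_m)$. For a probability measure $P$ on $\mathcal X$ let $W(\vec b,P)=E_P[\log\langle\vec X,\vec b\rangle]\in[-\infty,\infty)$, with $\log 0=-\infty$ and $0\cdot(-\infty)=0$. Let $\vec b_P$ denote a portfolio maximizing $W(\cdot,P)$. The quantity $W(\vec b_P,P)-W(\vec b_Q,P)$ is the regret of using a portfolio optimal for $Q$ when the distribution is $P$; if $\vec b_Q$ is not uniquely determined, the minimum over all portfolios $\vec b$ optimal for $Q$ is taken. The maximal values $W(\vec b_P,P)$ are taken to be finite, so that the regret is defined. Sufficiency condition. Let $S$ be the simplex of probability measures on $\mathcal X$. An isometry of $S$ is an affine bijection $S\to S$. An isomixture is a convex combination $\Phi=\sum_i p_i\Phi_i$ of isometries. An affine map $\Phi:S\to S$ is sufficient for $(P,Q)$ if there is an affine map $\Psi:S\to S$ with $\Psi(\Phi(P))=P$ and $\Psi(\Phi(Q))=Q$. A divergence $D(\cdot,\cdot)$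 on $S$ satisfies the sufficiency condition (iso-sufficiency) if $D(\Phi(P),\Phi(Q))=D(P,Q)$ for all $P,Q\in S$ and every isomixture $\Phi:S\to S$ that is sufficient for $(P,Q)$.
   Formalization: Adds the assumption that the divergence W(b_P,P) − W(b_Q,P) is not identically zero on probability measures on X; without it the claim fails, e.g. for m = 1 and X = {1,2,3}, where the divergence is 0 and so satisfies sufficiency but does not separate measures. *)

theory Defs
  imports "HOL-Probability.Probability"
begin

text \<open>A vector of assets or of price relatives is an element of \<^typ>\<open>real ^ 'm\<close>, the
  finite type \<^typ>\<open>'m\<close> being the list of assets.\<close>

definition portfolios :: "(real ^ 'm) set" where
  "portfolios = {b. (\<forall>i. 0 \<le> b $ i) \<and> (\<Sum>i\<in>UNIV. b $ i) = 1}"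

definition elog :: "real \<Rightarrow> ereal" where
  "elog r = (if r = 0 then - \<infinity> else ereal (ln r))"

text \<open>The expected growth rate \<open>W(b,P)\<close>. Only finitely supported \<open>P\<close> are ever used. Leaving
  the points outside the support out of the sum is the convention \<open>0 * (- \<infinity>) = 0\<close>.\<close>

definition growth :: "real ^ 'm \<Rightarrow> (real ^ 'm) pmf \<Rightarrow> ereal" where
  "growth b P = (\<Sum>x\<in>set_pmf P. ereal (pmf P x) * elog (x \<bullet> b))"

definition optimal_portfolios :: "(real ^ 'm) pmf \<Rightarrow> (real ^ 'm) set" where
  "optimal_portfolios P = {b \<in> portfolios. \<forall>c\<in>portfolios. growth c P \<le> growth b P}"

definition max_growth :: "(real ^ 'm) pmf \<Rightarrow> ereal" where
  "max_growth P = (SUP b\<in>portfolios. growth b P)"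

text \<open>The infimum is a minimum: \<open>growth b P\<close> is upper semicontinuous in \<open>b\<close> and
  \<^const>\<open>portfolios\<close> is compact, so \<open>optimal_portfolios Q\<close> is nonempty and compact. The regret is
  \<open>\<infinity>\<close> when every portfolio optimal for \<open>Q\<close> has growth rate \<open>- \<infinity>\<close> under \<open>P\<close>.\<close>

definition regret :: "(real ^ 'm) pmf \<Rightarrow> (real ^ 'm) pmf \<Rightarrow> ereal" where
  "regret P Q = (INF b\<in>optimal_portfolios Q. max_growth P - growth b P)"

definition prob_on :: "'a set \<Rightarrow> 'a pmf set" where
  "prob_on X = {P. set_pmf P \<subseteq> X}"

text \<open>The convex combination \<open>t P + (1 - t) Q\<close> for \<open>t\<close> in the unit interval.\<close>

definition mix_pmf :: "real \<Rightarrow> 'a pmf \<Rightarrow> 'a pmf \<Rightarrow> 'a pmf" where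
  "mix_pmf t P Q = bernoulli_pmf t \<bind> (\<lambda>c. if c then P else Q)"

definition affine_self_map :: "'a set \<Rightarrow> ('a pmf \<Rightarrow> 'a pmf) \<Rightarrow> bool" where
  "affine_self_map X \<Phi> \<longleftrightarrow>
     (\<forall>P\<in>prob_on X. \<Phi> P \<in> prob_on X) \<and>
     (\<forall>P\<in>prob_on X. \<forall>Q\<in>prob_on X. \<forall>t\<in>{0..1}. \<Phi> (mix_pmf t P Q) = mix_pmf t (\<Phi> P) (\<Phi> Q))"

definition simplex_isometry :: "'a set \<Rightarrow> ('a pmf \<Rightarrow> 'a pmf) \<Rightarrow> bool" where
  "simplex_isometry X \<Phi> \<longleftrightarrow> affine_self_map X \<Phi> \<and> bij_betw \<Phi> (prob_on X) (prob_on X)"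

text \<open>The weights of the convex combination are a finitely supported distribution \<open>p\<close> on
  isometries.\<close>

definition isomixture :: "'a set \<Rightarrow> ('a pmf \<Rightarrow> 'a pmf) \<Rightarrow> bool" where
  "isomixture X \<Phi> \<longleftrightarrow>
     (\<exists>p :: ('a pmf \<Rightarrow> 'a pmf) pmf. finite (set_pmf p) \<and>
        (\<forall>\<phi>\<in>set_pmf p. simplex_isometry X \<phi>) \<and>
        (\<forall>P\<in>prob_on X. \<Phi> P = p \<bind> (\<lambda>\<phi>. \<phi> P)))"

definition sufficient_for :: "'a set \<Rightarrow> ('a pmf \<Rightarrow> 'a pmf) \<Rightarrow> 'a pmf \<Rightarrow> 'a pmf \<Rightarrow> bool" where
  "sufficient_for X \<Phi> P Q \<longleftrightarrow>
     affine_self_map X \<Phi> \<and> (\<exists>\<Psi>. affine_self_map X \<Psi> \<and> \<Psi> (\<Phi> P) = P \<and> \<Psi> (\<Phi> Q) = Q)"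

definition iso_sufficiency :: "'a set \<Rightarrow> ('a pmf \<Rightarrow> 'a pmf \<Rightarrow> ereal) \<Rightarrow> bool" where
  "iso_sufficiency X D \<longleftrightarrow>
     (\<forall>P\<in>prob_on X. \<forall>Q\<in>prob_on X. \<forall>\<Phi>.
        isomixture X \<Phi> \<and> sufficient_for X \<Phi> P Q \<longrightarrow> D (\<Phi> P) (\<Phi> Q) = D P Q)"

end

theory Submission
  imports Defs
begin

text \<open>Let \<open>G P\<close> be the maximal growth rate. For \<open>M = t P + (1 - t) Q\<close> the combination
  \<open>t \<cdot> regret P M + (1 - t) \<cdot> regret Q M\<close> is the Jensen gap of the convex function \<open>G\<close>, so under the
  sufficiency condition Jensen gaps are invariant under sufficient isomixtures. A random permutation
  that fixes \<open>x\<close> and sends \<open>z\<close> to a point distributed as \<open>R\<close> is sufficient for the edge from \<open>x\<close> to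
  \<open>z\<close>. This yields the chain rule
  \<open>G (t \<delta>\<^sub>x + (1 - t) R) = f t + t G \<delta>\<^sub>x + (1 - t) G R\<close> with one convex function \<open>f\<close>. On three points the
  chain rule becomes the functional equation of the entropy, by which \<open>f\<close> is either strictly convex or
  zero. In the first case \<open>G\<close> is strictly convex and the regret separates points; in the second case
  \<open>G\<close> is affine and the regret vanishes identically.

  Conversely, write \<open>best x\<close> for the largest entry of \<open>x\<close>. If the regret separates points, then
  \<open>\<Sum>\<^sub>x x\<^sub>i / best x \<le> 1\<close> for each asset \<open>i\<close>: otherwise some single asset is optimal for two
  different distributions. The market is then at most as rich as a horse race, proportional betting is
  optimal, the regret is the Kullback-Leibler divergence, and the data processing inequality applies to
  \<open>\<Phi>\<close> and to \<open>\<Psi>\<close>.\<close>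

section \<open>Mixtures of probability mass functions\<close>

lemma pmf_mix_pmf:
  assumes "0 \<le> t" "t \<le> 1"
  shows "pmf (mix_pmf t P Q) x = t * pmf P x + (1 - t) * pmf Q x"
  using assms by (simp add: mix_pmf_def pmf_bind)

lemma mix_pmf_in_prob_on:
  assumes "P \<in> prob_on X" "Q \<in> prob_on X"
  shows "mix_pmf t P Q \<in> prob_on X"
  using assms by (auto simp: prob_on_def mix_pmf_def split: if_splits)

lemma return_pmf_in_prob_on: "x \<in> X \<Longrightarrow> return_pmf x \<in> prob_on X"
  by (simp add: prob_on_def)

lemma prob_on_mono: "P \<in> prob_on A \<Longrightarrow> A \<subseteq> B \<Longrightarrow> P \<in> prob_on B"
  by (auto simp: prob_on_def)

lemma pmf_eq_0_outside: "P \<in> prob_on X \<Longrightarrow> x \<notin> X \<Longrightarrow> pmf P x = 0"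
  by (auto simp: prob_on_def set_pmf_iff)

lemma sum_pmf_prob_on:
  assumes "finite X" "P \<in> prob_on X"
  shows "(\<Sum>x\<in>X. pmf P x) = 1"
  using assms by (intro sum_pmf_eq_1) (auto simp: prob_on_def)

lemma mix_pmf_0 [simp]: "mix_pmf 0 P Q = Q"
  by (rule pmf_eqI) (simp add: pmf_mix_pmf)

lemma mix_pmf_1 [simp]: "mix_pmf 1 P Q = P"
  by (rule pmf_eqI) (simp add: pmf_mix_pmf)

lemma mix_pmf_commute: "0 \<le> t \<Longrightarrow> t \<le> 1 \<Longrightarrow> mix_pmf t P Q = mix_pmf (1 - t) Q P"
  by (rule pmf_eqI) (simp add: pmf_mix_pmf)

lemma set_pmf_mix_pmf:
  assumes "0 < t" "t < 1"
  shows "set_pmf (mix_pmf t P Q) = set_pmf P \<union> set_pmf Q"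
  using assms by (auto simp: mix_pmf_def UNIV_bool)

lemma mix_pmf_bind:
  fixes K :: "'a \<Rightarrow> 'b pmf"
  shows "mix_pmf t P Q \<bind> K = mix_pmf t (P \<bind> K) (Q \<bind> K)"
  unfolding mix_pmf_def bind_assoc_pmf by (rule bind_pmf_cong) auto

lemma bind_mix_pmf:
  fixes K K' :: "'a \<Rightarrow> 'b pmf"
  shows "(p :: 'a pmf) \<bind> (\<lambda>y. mix_pmf t (K y) (K' y)) = mix_pmf t (p \<bind> K) (p \<bind> K')"
  unfolding mix_pmf_def
  by (subst bind_commute_pmf) (intro bind_pmf_cong refl, simp)

lemma map_mix_pmf: "map_pmf g (mix_pmf t P Q) = mix_pmf t (map_pmf g P) (map_pmf g Q)"
  by (simp add: map_pmf_def mix_pmf_bind)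

text \<open>\<open>R\<close> is \<open>P\<close> conditioned on avoiding \<open>x\<close>. If
  \<open>P\<close> is the point mass at \<open>x\<close> there is nothing to condition on, so
  \<open>R\<close> is then an arbitrary point mass elsewhere and the support claim excludes this
  case.\<close>

lemma pmf_split_point:
  assumes "P \<in> prob_on X" "finite X" "X - {x} \<noteq> {}"
  obtains R where "R \<in> prob_on (X - {x})" "P = mix_pmf (pmf P x) (return_pmf x) R"
    "set_pmf P \<noteq> {x} \<Longrightarrow> set_pmf R = set_pmf P - {x}"
proof (cases "set_pmf P = {x}")
  case True
  then have "P = return_pmf x" by (metis set_pmf_subset_singleton order_refl)
  moreover obtain z where "z \<in> X - {x}" using assms(3) by blast
  ultimately show ?thesis using that[of "return_pmf z"] True by (simp add: prob_on_def)
next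
  case False
  have ne: "set_pmf P \<inter> (- {x}) \<noteq> {}" using False set_pmf_not_empty[of P] by blast
  define R where "R = cond_pmf P (- {x})"
  have m: "measure_pmf.prob P (- {x}) = 1 - pmf P x"
    using measure_pmf.prob_compl[of "{x}" P] by (simp add: measure_pmf_single Compl_eq_Diff_UNIV)
  have pos: "1 - pmf P x \<noteq> 0"
    using m ne by (metis disjoint_iff measure_pmf_zero_iff)
  have sR: "set_pmf R = set_pmf P - {x}" unfolding R_def using set_cond_pmf[OF ne] by auto
  have "P = mix_pmf (pmf P x) (return_pmf x) R"
  proof (rule pmf_eqI)
    fix y
    show "pmf P y = pmf (mix_pmf (pmf P x) (return_pmf x) R) y"
      using pos by (auto simp: pmf_mix_pmf pmf_le_1 R_def pmf_cond[OF ne] m indicator_def)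
  qed
  moreover have "R \<in> prob_on (X - {x})" using sR assms(1) by (auto simp: prob_on_def)
  ultimately show ?thesis using that sR by blast
qed

text \<open>Atoms are peeled off one at a time, by induction on the size of the support. This
  carries statements from the vertices to the whole simplex.\<close>

lemma prob_on_induct [consumes 2, case_names return mix]:
  assumes "finite X" "P \<in> prob_on X"
    and ret: "\<And>x. x \<in> X \<Longrightarrow> H (return_pmf x)"
    and mix: "\<And>t x R. \<lbrakk>0 < t; t < 1; x \<in> X; R \<in> prob_on (X - {x}); H R\<rbrakk> \<Longrightarrow> H (mix_pmf t (return_pmf x) R)"
  shows "H P"
  using assms(2)
proof (induction "card (set_pmf P)" arbitrary: P rule: less_induct)
  case less
  obtain x where x: "x \<in> set_pmf P" using set_pmf_not_empty[of P] by blast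
  then have xX: "x \<in> X" using less.prems by (auto simp: prob_on_def)
  show ?case
  proof (cases "set_pmf P = {x}")
    case True
    then have "P = return_pmf x" by (metis set_pmf_subset_singleton order_refl)
    then show ?thesis using ret xX by simp
  next
    case False
    then have "X - {x} \<noteq> {}" using x less.prems by (auto simp: prob_on_def)
    then obtain R where R: "R \<in> prob_on (X - {x})" "P = mix_pmf (pmf P x) (return_pmf x) R"
        "set_pmf R = set_pmf P - {x}"
      using pmf_split_point[OF less.prems assms(1)] False by metis
    have fin: "finite (set_pmf P)" using less.prems assms(1) finite_subset by (auto simp: prob_on_def)
    have "card (set_pmf R) < card (set_pmf P)" unfolding R(3) by (rule card_Diff1_less[OF fin x])
    then have "H R" using less.hyps R(1) prob_on_mono[of R "X - {x}" X] by blast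
    moreover have "0 < pmf P x" using x by (simp add: pmf_positive)
    moreover have "pmf P x < 1"
    proof (rule ccontr)
      assume "\<not> pmf P x < 1"
      then have "pmf P x = 1" using pmf_le_1[of P x] by linarith
      then have "P = return_pmf x" using R(2) by simp
      then show False using False by simp
    qed
    ultimately show ?thesis using mix[of "pmf P x" x R] xX R by metis
  qed
qed

lemma pmf_of_weights:
  fixes w :: "'a \<Rightarrow> real"
  assumes "finite X" "\<And>x. x \<in> X \<Longrightarrow> 0 \<le> w x" "(\<Sum>x\<in>X. w x) = 1"
  obtains P where "P \<in> prob_on X" "\<And>x. x \<in> X \<Longrightarrow> pmf P x = w x"
proof -
  define v where "v x = (if x \<in> X then w x else 0)" for x
  have "(\<integral>\<^sup>+ x. ennreal (v x) \<partial>count_space UNIV) = (\<Sum>x\<in>X. ennreal (v x))"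
    by (rule nn_integral_count_space'[OF assms(1)]) (auto simp: v_def)
  also have "\<dots> = 1" using assms by (simp add: v_def)
  finally have pmf: "pmf (embed_pmf v) x = v x" for x
    by (intro pmf_embed_pmf) (auto simp: v_def assms)
  show ?thesis
    by (rule that[of "embed_pmf v"]) (auto simp: prob_on_def set_pmf_iff pmf v_def split: if_splits)
qed

text \<open>An affine map is determined by its values at the vertices, which form a Markov kernel.
  Data processing is later applied to this kernel.\<close>

lemma affine_self_map_kernel:
  fixes P :: "'a pmf"
  assumes "affine_self_map X \<Phi>" "finite X" "P \<in> prob_on X"
  shows "\<Phi> P = P \<bind> (\<lambda>x. \<Phi> (return_pmf x))"
  using assms(2,3)
proof (induction rule: prob_on_induct)
  case (return x)
  then show ?case by (simp add: bind_return_pmf)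
next
  case (mix t x R)
  then have "R \<in> prob_on X" by (auto simp: prob_on_def)
  then show ?case using mix assms(1)
    by (simp add: affine_self_map_def mix_pmf_bind bind_return_pmf return_pmf_in_prob_on)
qed

section \<open>The functional equation of the entropy\<close>

text \<open>Reflect \<open>u\<close> in the midpoint to \<open>v\<close>. Midpoint convexity bounds
  \<open>f u + f v\<close> below by the sum of the two chord values, while each summand lies below
  its chord value, so both are equal to it.\<close>

lemma convex_on_chord_eq:
  fixes f :: "real \<Rightarrow> real"
  assumes cvx: "convex_on {p..q} f" and "p < q" and mid: "f ((p + q) / 2) = (f p + f q) / 2"
    and u: "u \<in> {p..q}"
  shows "f u = f p + (f q - f p) / (q - p) * (u - p)"
proof (rule antisym)
  define c where "c v = f p + (f q - f p) / (q - p) * (v - p)" for v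
  have le: "f v \<le> c v" if "v \<in> {p..q}" for v
  proof -
    have "f v \<le> (f q - f p) / (q - p) * (v - p) + f p"
      using convex_onD_Icc'[OF cvx that] by simp
    then show ?thesis by (simp add: c_def)
  qed
  show "f u \<le> f p + (f q - f p) / (q - p) * (u - p)" using le[OF u] by (simp add: c_def)
  define v where "v = p + q - u"
  have v: "v \<in> {p..q}" using u by (auto simp: v_def)
  have "f ((1 - 1/2) *\<^sub>R u + (1/2) *\<^sub>R v) \<le> (1 - 1/2) * f u + (1/2) * f v"
    using convex_onD[OF cvx, of "1/2" u v] u v by simp
  moreover have "(1 - 1/2) *\<^sub>R u + (1/2) *\<^sub>R v = (p + q) / 2" by (simp add: v_def field_simps)
  ultimately have "f ((p + q) / 2) \<le> (1 - 1/2) * f u + (1/2) * f v" by (simp only:)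
  then have "f p + f q \<le> f u + f v" unfolding mid by simp
  moreover have "c u + c v = f p + f q"
  proof -
    define s where "s = (f q - f p) / (q - p)"
    have "c u + c v = 2 * f p + s * (q - p)"
      unfolding c_def v_def s_def[symmetric] by (simp add: algebra_simps)
    then show ?thesis using \<open>p < q\<close> by (simp add: s_def)
  qed
  ultimately show "f p + (f q - f p) / (q - p) * (u - p) \<le> f u"
    using le[OF v] by (simp add: c_def)
qed

lemma convex_on_perspective:
  fixes f :: "real \<Rightarrow> real"
  assumes "convex_on {0..1} f"
  shows "convex_on {0<..} (\<lambda>x. (1 + x) * f (1 / (1 + x)))"
proof (rule convex_onI)
  fix t x y :: real
  assume t: "0 < t" "t < 1" and xy: "x \<in> {0<..}" "y \<in> {0<..}"
  define z where "z = (1 - t) * x + t * y"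
  have pos: "0 < 1 + x" "0 < 1 + y" "0 < 1 + z" using xy t
    by (auto simp: z_def intro!: add_pos_pos mult_pos_pos)
  \<comment> \<open>The weight that makes \<open>1 / (1 + z)\<close> a convex combination of
    \<open>1 / (1 + x)\<close> and \<open>1 / (1 + y)\<close>. Multiplying by \<open>1 + z\<close>
    then clears all denominators.\<close>
  define s where "s = t * (1 + y) / (1 + z)"
  have s1: "1 - s = (1 - t) * (1 + x) / (1 + z)"
    using pos(3) by (simp add: s_def z_def field_simps)
  have s: "0 \<le> s" "s \<le> 1"
  proof -
    show "0 \<le> s" using pos t by (simp add: s_def)
    have "0 \<le> 1 - s" using pos t by (simp add: s1)
    then show "s \<le> 1" by simp
  qed
  have "f ((1 - s) *\<^sub>R (1 / (1 + x)) + s *\<^sub>R (1 / (1 + y))) \<le> (1 - s) * f (1 / (1 + x)) + s * f (1 / (1 + y))"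
    using xy by (intro convex_onD[OF assms s]) auto
  moreover have "(1 - s) *\<^sub>R (1 / (1 + x)) + s *\<^sub>R (1 / (1 + y)) = 1 / (1 + z)"
  proof -
    have "(1 - s) *\<^sub>R (1 / (1 + x)) = (1 - t) / (1 + z)" "s *\<^sub>R (1 / (1 + y)) = t / (1 + z)"
      unfolding s1 unfolding s_def using pos by simp_all
    then show ?thesis by (simp add: add_divide_distrib[symmetric])
  qed
  ultimately have "f (1 / (1 + z)) \<le> ((1 - t) * (1 + x)  * f (1 / (1 + x)) + t * (1 + y) * f (1 / (1 + y))) / (1 + z)"
    unfolding s1 unfolding s_def by (simp add: add_divide_distrib)
  then have "(1 + z) * f (1 / (1 + z)) \<le> (1 - t) * (1 + x)  * f (1 / (1 + x)) + t * (1 + y) * f (1 / (1 + y))"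
    using pos by (simp add: field_simps)
  then show "(1 + ((1 - t) *\<^sub>R x + t *\<^sub>R y)) * f (1 / (1 + ((1 - t) *\<^sub>R x + t *\<^sub>R y)))
     \<le> (1 - t) * ((1 + x) * f (1 / (1 + x))) + t * ((1 + y) * f (1 / (1 + y)))"
    by (simp add: z_def mult.assoc)
qed simp

text \<open>The derivative is locally constant, hence constant on the half-line. Subtracting the
  linear part leaves a function with derivative zero.\<close>

lemma locally_affine_imp_affine:
  fixes g :: "real \<Rightarrow> real"
  assumes "\<And>x. 0 < x \<Longrightarrow> \<exists>p q k c. p < x \<and> x < q \<and> (\<forall>y\<in>{p<..<q}. g y = k * y + c)"
  obtains k c where "\<And>x. 0 < x \<Longrightarrow> g x = k * x + c"
proof -
  have loc: "\<exists>k c. (\<forall>\<^sub>F y in nhds x. g y = k * y + c)" if x: "0 < x" for x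
  proof -
    obtain p q k c where pq: "p < x" "x < q" "\<forall>y\<in>{p<..<q}. g y = k * y + c" using assms[OF x] by blast
    have "\<forall>\<^sub>F y in nhds x. y \<in> {p<..<q}" by (intro eventually_nhds_in_open) (use pq in auto)
    then have "\<forall>\<^sub>F y in nhds x. g y = k * y + c" by eventually_elim (use pq in auto)
    then show ?thesis by blast
  qed
  have der: "\<exists>k. (g has_real_derivative k) (at x) \<and> (\<forall>\<^sub>F y in nhds x. deriv g y = k)" if x: "0 < x" for x
  proof -
    obtain k c where ev: "\<forall>\<^sub>F y in nhds x. g y = k * y + c" using loc[OF x] by blast
    have d: "((\<lambda>y. k * y + c) has_real_derivative k) (at y)" for y by (auto intro!: derivative_eq_intros)
    have "\<forall>\<^sub>F y in nhds x. \<forall>\<^sub>F z in nhds y. g z = k * z + c"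
      using ev by (simp add: eventually_eventually)
    then have "\<forall>\<^sub>F y in nhds x. (g has_real_derivative k) (at y)"
    proof eventually_elim
      case (elim y)
      then show ?case using d[of y] by (simp add: DERIV_cong_ev[OF refl elim refl])
    qed
    then have "\<forall>\<^sub>F y in nhds x. (g has_real_derivative k) (at y) \<and> deriv g y = k"
      by eventually_elim (auto intro: DERIV_imp_deriv)
    then show ?thesis by (auto simp: eventually_conj_iff dest: eventually_nhds_x_imp_x)
  qed
  have "\<exists>k. \<forall>x\<in>{0<..}. deriv g x = k"
  proof (rule has_field_derivative_zero_constant)
    show "(deriv g has_real_derivative 0) (at x within {0<..})" if x: "x \<in> {0<..}" for x
    proof -
      obtain k where "\<forall>\<^sub>F y in nhds x. deriv g y = k" using der x by auto
      then have "(deriv g has_real_derivative 0) (at x)"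
        by (subst DERIV_cong_ev[OF refl _ refl, where g = "\<lambda>_. k"]) auto
      then show ?thesis by (rule has_field_derivative_at_within)
    qed
  qed simp
  then obtain k where k: "\<And>x. 0 < x \<Longrightarrow> deriv g x = k" by auto
  have "\<exists>c. \<forall>x\<in>{0<..}. g x - k * x = c"
  proof (rule has_field_derivative_zero_constant)
    show "((\<lambda>x. g x - k * x) has_real_derivative 0) (at x within {0<..})" if x: "x \<in> {0<..}" for x
    proof -
      have "(g has_real_derivative k) (at x)" using der[of x] k[of x] x by (auto dest: DERIV_imp_deriv)
      then have "((\<lambda>x. g x - k * x) has_real_derivative 0) (at x)"
        by (auto intro!: derivative_eq_intros)
      then show ?thesis by (rule has_field_derivative_at_within)
    qed
  qed simp
  then obtain c where "\<And>x. 0 < x \<Longrightarrow> g x - k * x = c" by auto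
  then have "\<And>x. 0 < x \<Longrightarrow> g x = k * x + c" by (simp add: algebra_simps)
  then show ?thesis using that by blast
qed

text \<open>With \<open>\<psi> x = (1 + x) f (1 / (1 + x))\<close> and \<open>s = 1 - a\<close>, the functional equation reads
  \<open>f a + s f u = f (s (1 - u)) + a \<psi> (s u / a)\<close>. Both \<open>u\<close>-dependent terms on the right are convex, so
  if the left-hand side is affine in \<open>u\<close> on an interval, then so is each of them.
  Varying \<open>a\<close> rescales the interval arbitrarily, and \<open>\<psi>\<close> is affine everywhere.\<close>

lemma entropy_equation_rigidity:
  fixes f :: "real \<Rightarrow> real"
  assumes cvx: "convex_on {0..1} f"
    and sym: "\<And>u. 0 \<le> u \<Longrightarrow> u \<le> 1 \<Longrightarrow> f (1 - u) = f u"
    and feq: "\<And>a b c. \<lbrakk>0 < a; 0 < b; 0 < c; a + b + c = 1\<rbrakk> \<Longrightarrow>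
      f a + (1 - a) * f (b / (1 - a)) = f c + (1 - c) * f (a / (1 - c))"
    and pq: "0 \<le> p" "p < q" "q \<le> 1" and mid: "f ((p + q) / 2) = (f p + f q) / 2"
    and u: "0 < u" "u < 1"
  shows "f u = 0"
proof -
  have cvx_sub: "convex_on {p'..q'} f" if "0 \<le> p'" "q' \<le> 1" for p' q'
    by (rule convex_on_subset[OF cvx]) (use that in auto)
  define slope where "slope = (f q - f p) / (q - p)"
  have aff: "f v = f p + slope * (v - p)" if "v \<in> {p..q}" for v
    using convex_on_chord_eq[OF cvx_sub[OF pq(1,3)] pq(2) mid that] by (simp add: slope_def)
  \<comment> \<open>The middle third of the interval stays away from 0 and 1, as \<open>eq\<close>
    below requires, and \<open>f\<close> is still affine on it.\<close>
  define p' q' where "p' = (2 * p + q) / 3" and "q' = (p + 2 * q) / 3"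
  have p'q': "0 < p'" "p' < q'" "q' < 1" "p' \<in> {p..q}" "q' \<in> {p..q}" "(p' + q') / 2 \<in> {p..q}"
    using pq by (auto simp: p'_def q'_def field_simps)
  have mid': "2 * f ((p' + q') / 2) = f p' + f q'"
    unfolding aff[OF p'q'(4)] aff[OF p'q'(5)] aff[OF p'q'(6)] by (simp add: algebra_simps)
  define \<psi> where "\<psi> x = (1 + x) * f (1 / (1 + x))" for x
  have cvx_\<psi>: "convex_on {0<..} \<psi>" unfolding \<psi>_def by (rule convex_on_perspective[OF cvx])
  have eq: "f a + (1 - a) * f v = f ((1 - a) * (1 - v)) + a * \<psi> ((1 - a) / a * v)"
    if "0 < a" "a < 1" "0 < v" "v < 1" for a v
  proof -
    define b c where "b = (1 - a) * v" and "c = (1 - a) * (1 - v)"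
    have "0 < b" "0 < c" unfolding b_def c_def using that by (auto intro!: mult_pos_pos)
    moreover have "a + b + c = 1" by (simp add: b_def c_def algebra_simps)
    ultimately have abc: "0 < b" "0 < c" "a + b + c = 1" .
    have c1: "1 - c = a + b" using abc by simp
    have "a * \<psi> (b / a) = (a + b) * f (a / (a + b))"
    proof -
      have "1 + b / a = (a + b) / a" using that by (simp add: field_simps)
      then show ?thesis using that by (simp add: \<psi>_def)
    qed
    then show ?thesis using feq[OF that(1) abc] that unfolding c1 by (simp add: b_def c_def)
  qed
  have \<psi>_mid: "\<psi> ((\<tau> * p' + \<tau> * q') / 2) = (\<psi> (\<tau> * p') + \<psi> (\<tau> * q')) / 2" if \<tau>: "0 < \<tau>" for \<tau>
  proof -
    \<comment> \<open>Chosen so that the scaling factor \<open>(1 - a) / a\<close> in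
      \<open>eq\<close> is \<tau>.\<close>
    define a where "a = 1 / (1 + \<tau>)"
    have a: "0 < a" "a < 1" "(1 - a) / a = \<tau>" using \<tau> by (auto simp: a_def field_simps)
    define m where "m = (p' + q') / 2"
    have m: "0 < m" "m < 1" using p'q' by (auto simp: m_def)
    define P Q where "P = (1 - a) * (1 - p')" and "Q = (1 - a) * (1 - q')"
    have PQ: "P \<in> {0..1}" "Q \<in> {0..1}" using a p'q' by (auto simp: P_def Q_def mult_le_one)
    have "f ((1 - 1/2) *\<^sub>R P + (1/2) *\<^sub>R Q) \<le> (1 - 1/2) * f P + (1/2) * f Q"
      using convex_onD[OF cvx, of "1/2" P Q] PQ by simp
    moreover have "(1 - 1/2) *\<^sub>R P + (1/2) *\<^sub>R Q = (1 - a) * (1 - m)"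
      by (simp add: P_def Q_def m_def field_simps)
    ultimately have 1: "2 * f ((1 - a) * (1 - m)) \<le> f P + f Q" by simp
    have "\<psi> ((1 - 1/2) *\<^sub>R (\<tau> * p') + (1/2) *\<^sub>R (\<tau> * q')) \<le> (1 - 1/2) * \<psi> (\<tau> * p') + (1/2) * \<psi> (\<tau> * q')"
      using convex_onD[OF cvx_\<psi>, of "1/2" "\<tau> * p'" "\<tau> * q'"] \<tau> p'q' by simp
    moreover have "(1 - 1/2) *\<^sub>R (\<tau> * p') + (1/2) *\<^sub>R (\<tau> * q') = \<tau> * m"
      by (simp add: m_def field_simps)
    ultimately have 2: "2 * \<psi> (\<tau> * m) \<le> \<psi> (\<tau> * p') + \<psi> (\<tau> * q')" by simp
    \<comment> \<open>The left-hand sides are affine in the last argument, so the midpoint convexity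
      gaps of the two right-hand terms add up to zero. Both gaps are nonnegative by \<open>1\<close>
      and \<open>2\<close>, so the one of \<psi> vanishes.\<close>
    have "f a + (1 - a) * f p' = f P + a * \<psi> (\<tau> * p')" "f a + (1 - a) * f q' = f Q + a * \<psi> (\<tau> * q')"
      "f a + (1 - a) * f m = f ((1 - a) * (1 - m)) + a * \<psi> (\<tau> * m)"
      using eq[OF a(1,2)] a(3) p'q' m by (auto simp: P_def Q_def)
    moreover have "2 * ((1 - a) * f m) = (1 - a) * f p' + (1 - a) * f q'"
      using mid' by (simp add: m_def algebra_simps)
    ultimately have "2 * (a * \<psi> (\<tau> * m)) \<ge> a * \<psi> (\<tau> * p') + a * \<psi> (\<tau> * q')" using 1 by linarith
    then have "a * (2 * \<psi> (\<tau> * m)) \<ge> a * (\<psi> (\<tau> * p') + \<psi> (\<tau> * q'))" by (simp add: algebra_simps)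
    then have "2 * \<psi> (\<tau> * m) \<ge> \<psi> (\<tau> * p') + \<psi> (\<tau> * q')" using a(1) by (simp del: mult.left_commute)
    moreover have "(\<tau> * p' + \<tau> * q') / 2 = \<tau> * m" by (simp add: m_def algebra_simps)
    ultimately show ?thesis using 2 by simp
  qed
  obtain k c where kc: "\<And>x. 0 < x \<Longrightarrow> \<psi> x = k * x + c"
  proof (rule locally_affine_imp_affine[of \<psi>])
    fix x :: real assume x: "0 < x"
    \<comment> \<open>Puts the midpoint of the rescaled interval at \<open>x\<close>.\<close>
    define \<tau> where "\<tau> = 2 * x / (p' + q')"
    have \<tau>: "0 < \<tau>" using x p'q' by (simp add: \<tau>_def)
    have b: "\<tau> * p' < x" "x < \<tau> * q'" using x p'q' by (auto simp: \<tau>_def field_simps)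
    have lt: "\<tau> * p' < \<tau> * q'" using b by simp
    have cv: "convex_on {\<tau> * p'..\<tau> * q'} \<psi>"
    proof (rule convex_on_subset[OF cvx_\<psi>])
      have "0 < \<tau> * p'" using \<tau> p'q' by simp
      then show "{\<tau> * p'..\<tau> * q'} \<subseteq> {0<..}" by auto
    qed simp
    define s where "s = (\<psi> (\<tau> * q') - \<psi> (\<tau> * p')) / (\<tau> * q' - \<tau> * p')"
    have "\<psi> y = s * y + (\<psi> (\<tau> * p') - s * (\<tau> * p'))" if "y \<in> {\<tau> * p'<..<\<tau> * q'}" for y
      using convex_on_chord_eq[OF cv lt \<psi>_mid[OF \<tau>], of y] that unfolding s_def[symmetric]
      by (simp add: algebra_simps)
    then show "\<exists>p q k c. p < x \<and> x < q \<and> (\<forall>y\<in>{p<..<q}. \<psi> y = k * y + c)" using b by blast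
  qed blast
  \<comment> \<open>Inversion of the definition of \<psi>, evaluated at
    \<open>1 / v - 1\<close>.\<close>
  have f_aff: "f v = k * (1 - v) + c * v" if "0 < v" "v < 1" for v
  proof -
    have pos: "0 < 1 / v - 1" using that by simp
    have "1 / v * f v = k * (1 / v - 1) + c" using kc[OF pos] that by (simp add: \<psi>_def)
    then have "v * (1 / v * f v) = v * (k * (1 / v - 1) + c)" by simp
    then show ?thesis using that by (simp add: algebra_simps)
  qed
  have "k = c" using f_aff[of "1/3"] f_aff[of "2/3"] sym[of "1/3"] by simp
  then have const: "f v = c" if "0 < v" "v < 1" for v using f_aff[OF that] by (simp add: algebra_simps)
  \<comment> \<open>For constant \<open>f\<close> the equation compares \<open>1 - a = 5/6\<close>
    with \<open>1 - c = 2/3\<close> times the same constant, which forces it to be zero.\<close>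
  have "c = 0" using feq[of "1/6" "1/2" "1/3"] by (simp add: const)
  then show ?thesis using const u by simp
qed

section \<open>Optimal portfolios\<close>

lemma compact_portfolios: "compact (portfolios :: (real ^ 'm) set)"
proof -
  have "portfolios = (\<Inter>i. {b :: real ^ 'm. 0 \<le> b $ i}) \<inter> {b. (\<Sum>i\<in>UNIV. b $ i) = 1}"
    by (auto simp: portfolios_def)
  also have "closed \<dots>"
    by (intro closed_Int closed_INT ballI closed_Collect_le closed_Collect_eq continuous_intros)
  finally have "closed (portfolios :: (real ^ 'm) set)" .
  moreover have "bounded (portfolios :: (real ^ 'm) set)"
    unfolding bounded_iff
  proof (intro exI ballI)
    fix b :: "real ^ 'm" assume "b \<in> portfolios"
    then have "(\<Sum>i\<in>UNIV. \<bar>b $ i\<bar>) = 1" by (simp add: portfolios_def)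
    then show "norm b \<le> 1" using norm_le_l1_cart[of b] by simp
  qed
  ultimately show ?thesis by (simp add: compact_eq_bounded_closed)
qed

lemma axis_in_portfolios: "axis i 1 \<in> portfolios"
  by (simp add: portfolios_def axis_def)

lemma convex_portfolios: "convex portfolios"
  by (intro convexI) (auto simp: portfolios_def sum.distrib sum_distrib_left[symmetric])

text \<open>For nonnegative vectors and finite \<open>X\<close>, \<open>finite_max\<close> amounts
  to excluding the zero vector from \<open>X\<close>.\<close>

locale market =
  fixes X :: "(real ^ 'm) set"
  assumes finite_X: "finite X"
    and nonneg: "\<And>x i. x \<in> X \<Longrightarrow> 0 \<le> x $ i"
    and finite_max: "\<And>P. P \<in> prob_on X \<Longrightarrow> \<bar>max_growth P\<bar> \<noteq> \<infinity>"
begin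

text \<open>Real-valued, hence affine in \<open>P\<close> without side conditions on infinities. At
  a zero return \<open>ln\<close> is only a dummy value, so agreement with \<open>growth\<close>
  needs positive returns on the support.\<close>

definition log_growth :: "real ^ 'm \<Rightarrow> (real ^ 'm) pmf \<Rightarrow> real" where
  "log_growth b P = (\<Sum>x\<in>X. pmf P x * ln (x \<bullet> b))"

definition max_log_growth :: "(real ^ 'm) pmf \<Rightarrow> real" where
  "max_log_growth P = real_of_ereal (max_growth P)"

lemma max_growth_eq: "P \<in> prob_on X \<Longrightarrow> max_growth P = ereal (max_log_growth P)"
  using finite_max by (simp add: max_log_growth_def ereal_real')

lemma in_X: "P \<in> prob_on X \<Longrightarrow> x \<in> set_pmf P \<Longrightarrow> x \<in> X"
  by (auto simp: prob_on_def)

lemma inner_nonneg: "x \<in> X \<Longrightarrow> b \<in> portfolios \<Longrightarrow> 0 \<le> x \<bullet> b"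
  by (auto simp: inner_vec_def portfolios_def nonneg intro!: sum_nonneg)

lemma log_growth_support:
  assumes "P \<in> prob_on X"
  shows "log_growth b P = (\<Sum>x\<in>set_pmf P. pmf P x * ln (x \<bullet> b))"
  unfolding log_growth_def
  using assms finite_X by (intro sum.mono_neutral_right) (auto simp: prob_on_def set_pmf_iff)

lemma growth_eq_log_growth:
  assumes "P \<in> prob_on X" "\<And>x. x \<in> set_pmf P \<Longrightarrow> 0 < x \<bullet> b"
  shows "growth b P = ereal (log_growth b P)"
proof -
  have "growth b P = (\<Sum>x\<in>set_pmf P. ereal (pmf P x * ln (x \<bullet> b)))"
    unfolding growth_def
  proof (intro sum.cong refl)
    fix x assume "x \<in> set_pmf P"
    then have "x \<bullet> b \<noteq> 0" using assms(2) by force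
    then show "ereal (pmf P x) * elog (x \<bullet> b) = ereal (pmf P x * ln (x \<bullet> b))" by (simp add: elog_def)
  qed
  then show ?thesis by (simp add: log_growth_support[OF assms(1)])
qed

lemma growth_cases:
  assumes "P \<in> prob_on X" "b \<in> portfolios"
  obtains (infinite) "growth b P = - \<infinity>"
  | (finite) "\<And>x. x \<in> set_pmf P \<Longrightarrow> 0 < x \<bullet> b" "growth b P = ereal (log_growth b P)"
proof (cases "\<forall>x\<in>set_pmf P. 0 < x \<bullet> b")
  case True
  then show ?thesis using growth_eq_log_growth[OF assms(1)] finite by blast
next
  case False
  then obtain x where x: "x \<in> set_pmf P" "\<not> 0 < x \<bullet> b" by blast
  have x0: "x \<bullet> b = 0" using x inner_nonneg[OF in_X[OF assms(1)] assms(2)] by fastforce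
  have fin: "finite (set_pmf P)" using assms(1) finite_X finite_subset by (auto simp: prob_on_def)
  define h where "h y = ereal (pmf P y) * elog (y \<bullet> b)" for y
  have "h x = - \<infinity>" using x x0 pmf_positive[OF x(1)] by (simp add: h_def elog_def)
  moreover have "sum h (set_pmf P - {x}) \<noteq> \<infinity>"
  proof -
    have "h y \<noteq> \<infinity>" for y by (auto simp: h_def elog_def ereal_mult_eq_PInfty pmf_nonneg)
    then show ?thesis by (simp add: sum_Pinfty)
  qed
  moreover have "growth b P = h x + sum h (set_pmf P - {x})"
    unfolding growth_def h_def[symmetric] using fin x(1) by (simp add: sum.remove)
  ultimately have "growth b P = - \<infinity>" by (cases "sum h (set_pmf P - {x})") auto
  then show ?thesis by (rule infinite)
qed

text \<open>Unlike \<open>growth\<close>, the product is a continuous real function of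
  \<open>b\<close> even where returns vanish, since the exponents are positive. Optimal portfolios
  then exist by compactness.\<close>

lemma growth_eq_elog_prod:
  assumes "P \<in> prob_on X" "b \<in> portfolios"
  shows "growth b P = elog (\<Prod>x\<in>set_pmf P. (x \<bullet> b) powr pmf P x)"
proof -
  have fin: "finite (set_pmf P)" using assms(1) finite_X finite_subset by (auto simp: prob_on_def)
  show ?thesis
  proof (cases "\<forall>x\<in>set_pmf P. 0 < x \<bullet> b")
    case True
    then have "(\<Prod>x\<in>set_pmf P. (x \<bullet> b) powr pmf P x) = exp (log_growth b P)"
      unfolding log_growth_support[OF assms(1)] exp_sum[OF fin]
      by (intro prod.cong) (auto simp: powr_def)
    then show ?thesis using growth_eq_log_growth[OF assms(1)] True by (simp add: elog_def)
  next
    case False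
    then obtain x where x: "x \<in> set_pmf P" "\<not> 0 < x \<bullet> b" by blast
    then have "x \<bullet> b = 0" using inner_nonneg[OF in_X[OF assms(1)] assms(2)] by fastforce
    then have "(\<Prod>x\<in>set_pmf P. (x \<bullet> b) powr pmf P x) = 0" using fin x by auto
    moreover have "growth b P = - \<infinity>" using assms by (rule growth_cases) (use x in auto)
    ultimately show ?thesis by (simp add: elog_def)
  qed
qed

lemma optimal_portfolios_nonempty:
  assumes P: "P \<in> prob_on X"
  obtains b where "b \<in> optimal_portfolios P"
proof -
  define h where "h b = (\<Prod>x\<in>set_pmf P. (x \<bullet> b) powr pmf P x)" for b
  have "continuous_on portfolios h"
    unfolding h_def
    by (intro continuous_on_prod continuous_on_powr' continuous_intros)
      (auto simp: pmf_positive intro: inner_nonneg[OF in_X[OF P]])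
  moreover have "portfolios \<noteq> ({} :: (real ^ 'm) set)" using axis_in_portfolios by blast
  ultimately have "\<exists>b\<in>portfolios. \<forall>c\<in>portfolios. h c \<le> h b"
    by (intro continuous_attains_sup compact_portfolios)
  then obtain b where b: "b \<in> portfolios" "\<And>c. c \<in> portfolios \<Longrightarrow> h c \<le> h b"
    by (elim bexE) simp
  have "elog (h c) \<le> elog (h b)" if "c \<in> portfolios" for c
  proof -
    have "0 \<le> h c" unfolding h_def by (intro prod_nonneg) auto
    then show ?thesis using b(2)[OF that] by (auto simp: elog_def)
  qed
  then show ?thesis using that[of b] b(1) growth_eq_elog_prod[OF P]
    by (simp add: optimal_portfolios_def h_def)
qed

lemma optimal_in_portfolios: "b \<in> optimal_portfolios P \<Longrightarrow> b \<in> portfolios"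
  by (simp add: optimal_portfolios_def)

lemma growth_optimal: "b \<in> optimal_portfolios P \<Longrightarrow> growth b P = max_growth P"
  unfolding max_growth_def optimal_portfolios_def by (intro antisym SUP_upper SUP_least) auto

lemma
  assumes P: "P \<in> prob_on X" and b: "b \<in> optimal_portfolios P"
  shows inner_optimal_pos: "\<And>x. x \<in> set_pmf P \<Longrightarrow> 0 < x \<bullet> b"
    and log_growth_optimal: "log_growth b P = max_log_growth P"
proof -
  have eq: "growth b P = ereal (max_log_growth P)"
    using growth_optimal[OF b] max_growth_eq[OF P] by simp
  from P optimal_in_portfolios[OF b]
  have "(\<forall>x\<in>set_pmf P. 0 < x \<bullet> b) \<and> log_growth b P = max_log_growth P"
    by (rule growth_cases) (use eq in auto)
  then show "\<And>x. x \<in> set_pmf P \<Longrightarrow> 0 < x \<bullet> b" "log_growth b P = max_log_growth P" by auto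
qed

lemma log_growth_le_max:
  assumes "P \<in> prob_on X" "b \<in> portfolios" "\<And>x. x \<in> set_pmf P \<Longrightarrow> 0 < x \<bullet> b"
  shows "log_growth b P \<le> max_log_growth P"
proof -
  have "growth b P \<le> max_growth P" unfolding max_growth_def using assms(2) by (rule SUP_upper)
  then show ?thesis using growth_eq_log_growth[OF assms(1,3)] max_growth_eq[OF assms(1)] by simp
qed

lemma optimalI:
  assumes P: "P \<in> prob_on X" and b: "b \<in> portfolios" "\<And>x. x \<in> set_pmf P \<Longrightarrow> 0 < x \<bullet> b"
    and max: "\<And>c. \<lbrakk>c \<in> portfolios; \<And>x. x \<in> set_pmf P \<Longrightarrow> 0 < x \<bullet> c\<rbrakk> \<Longrightarrow> log_growth c P \<le> log_growth b P"
  shows "b \<in> optimal_portfolios P"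
proof -
  have "growth c P \<le> growth b P" if c: "c \<in> portfolios" for c
    using P c by (rule growth_cases) (use max[OF c] growth_eq_log_growth[OF P b(2)] in auto)
  then show ?thesis using b(1) by (simp add: optimal_portfolios_def)
qed

text \<open>Strict concavity of the logarithm, applied at the midpoint of two optimal portfolios.\<close>

lemma inner_optimal_unique:
  assumes P: "P \<in> prob_on X" and b: "b \<in> optimal_portfolios P" "b' \<in> optimal_portfolios P"
    and x: "x \<in> set_pmf P"
  shows "x \<bullet> b = x \<bullet> b'"
proof (rule ccontr)
  assume ne: "x \<bullet> b \<noteq> x \<bullet> b'"
  note pos = inner_optimal_pos[OF P b(1)] inner_optimal_pos[OF P b(2)]
  define c where "c = (1/2) *\<^sub>R b + (1/2) *\<^sub>R b'"
  have c: "c \<in> portfolios"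
    unfolding c_def using b[THEN optimal_in_portfolios]
    by (intro convexD[OF convex_portfolios]) auto
  have yc: "y \<bullet> c = (y \<bullet> b + y \<bullet> b') / 2" for y
    by (simp add: c_def inner_add_right)
  have cpos: "0 < y \<bullet> c" if "y \<in> set_pmf P" for y using pos[OF that] by (simp add: yc)
  have "ln m - (ln s + ln t) / 2 = ln (m\<^sup>2 / (s * t)) / 2"
    if "0 < s" "0 < t" "0 < m" for s t m :: real
    using that by (simp add: ln_div ln_mult ln_realpow field_simps)
  then have gap: "ln ((s + t) / 2) - (ln s + ln t) / 2 = ln (((s + t) / 2)\<^sup>2 / (s * t)) / 2"
    if "0 < s" "0 < t" for s t :: real using that by simp
  \<comment> \<open>The ratio inside the logarithm in \<open>gap\<close> therefore exceeds 1 by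
    \<open>((s - t) / 2)^2 / (s * t)\<close>, which is positive unless \<open>s = t\<close>.\<close>
  have amgm: "((s + t) / 2)\<^sup>2 = s * t + ((s - t) / 2)\<^sup>2" for s t :: real
    by (simp add: power2_eq_square field_simps)
  have le: "(ln s + ln t) / 2 \<le> ln ((s + t) / 2)" if "0 < s" "0 < t" for s t :: real
  proof -
    have "1 \<le> ((s + t) / 2)\<^sup>2 / (s * t)" using that by (simp add: amgm)
    then have "0 \<le> ln (((s + t) / 2)\<^sup>2 / (s * t))" by (rule ln_ge_zero)
    then show ?thesis using gap[OF that] by linarith
  qed
  have lt: "(ln s + ln t) / 2 < ln ((s + t) / 2)" if "0 < s" "0 < t" "s \<noteq> t" for s t :: real
  proof -
    have "1 < ((s + t) / 2)\<^sup>2 / (s * t)" using that by (simp add: amgm)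
    then have "0 < ln (((s + t) / 2)\<^sup>2 / (s * t))" by (rule ln_gt_zero)
    then show ?thesis using gap[OF that(1,2)] by linarith
  qed
  have "log_growth c P > (\<Sum>y\<in>set_pmf P. pmf P y * ((ln (y \<bullet> b) + ln (y \<bullet> b')) / 2))"
    unfolding log_growth_support[OF P]
  proof (rule sum_strict_mono_ex1)
    show "finite (set_pmf P)" using P finite_X finite_subset by (auto simp: prob_on_def)
    show "\<forall>y\<in>set_pmf P. pmf P y * ((ln (y \<bullet> b) + ln (y \<bullet> b')) / 2) \<le> pmf P y * ln (y \<bullet> c)"
      unfolding yc using le pos by (intro ballI mult_left_mono) auto
    show "\<exists>y\<in>set_pmf P. pmf P y * ((ln (y \<bullet> b) + ln (y \<bullet> b')) / 2) < pmf P y * ln (y \<bullet> c)"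
      unfolding yc using lt[OF pos[OF x] ne] x
      by (intro bexI[of _ x] mult_strict_left_mono) (auto simp: pmf_positive)
  qed
  also have "(\<Sum>y\<in>set_pmf P. pmf P y * ((ln (y \<bullet> b) + ln (y \<bullet> b')) / 2))
      = (log_growth b P + log_growth b' P) / 2"
    unfolding log_growth_support[OF P] sum.distrib[symmetric] sum_divide_distrib
    by (intro sum.cong) (auto simp: algebra_simps)
  also have "\<dots> = max_log_growth P" using log_growth_optimal[OF P] b by simp
  finally show False using log_growth_le_max[OF P c cpos] by simp
qed

lemma log_growth_mix:
  assumes "0 \<le> t" "t \<le> 1"
  shows "log_growth b (mix_pmf t P Q) = t * log_growth b P + (1 - t) * log_growth b Q"
  unfolding log_growth_def pmf_mix_pmf[OF assms] sum_distrib_left sum.distrib[symmetric]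
  by (intro sum.cong) (auto simp: algebra_simps)

lemma regret_nonneg:
  assumes P: "P \<in> prob_on X"
  shows "0 \<le> regret P Q"
  unfolding regret_def
proof (rule INF_greatest)
  fix b assume "b \<in> optimal_portfolios Q"
  then have "growth b P \<le> max_growth P"
    unfolding max_growth_def by (intro SUP_upper optimal_in_portfolios)
  then show "0 \<le> max_growth P - growth b P"
    using max_growth_eq[OF P] by (cases "growth b P") auto
qed

lemma regret_eq_0:
  assumes P: "P \<in> prob_on X" and b: "b \<in> optimal_portfolios P" "b \<in> optimal_portfolios Q"
  shows "regret P Q = 0"
proof (rule antisym)
  have "regret P Q \<le> max_growth P - growth b P"
    unfolding regret_def using b(2) by (rule INF_lower)
  also have "\<dots> = 0" using growth_optimal[OF b(1)] max_growth_eq[OF P] by simp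
  finally show "regret P Q \<le> 0" .
qed (rule regret_nonneg[OF P])

text \<open>All portfolios optimal for \<open>Q\<close> have the same returns on the support of
  \<open>Q\<close>, which contains that of \<open>P\<close>. The infimum defining the regret is then
  over a constant.\<close>

lemma regret_dominated:
  assumes P: "P \<in> prob_on X" and Q: "Q \<in> prob_on X" and sub: "set_pmf P \<subseteq> set_pmf Q"
    and b: "b \<in> optimal_portfolios Q"
  shows "regret P Q = ereal (max_log_growth P - log_growth b P)"
proof -
  have "max_growth P - growth c P = ereal (max_log_growth P - log_growth b P)"
    if c: "c \<in> optimal_portfolios Q" for c
  proof -
    have "growth c P = ereal (log_growth c P)"
      using inner_optimal_pos[OF Q c] sub by (intro growth_eq_log_growth[OF P]) auto
    moreover have "log_growth c P = log_growth b P"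
      unfolding log_growth_support[OF P] using inner_optimal_unique[OF Q c b] sub
      by (intro sum.cong) auto
    ultimately show ?thesis using max_growth_eq[OF P] by simp
  qed
  then have "regret P Q = (INF c\<in>optimal_portfolios Q. ereal (max_log_growth P - log_growth b P))"
    unfolding regret_def by (intro INF_cong) auto
  also have "\<dots> = ereal (max_log_growth P - log_growth b P)" using b by (intro INF_const) auto
  finally show ?thesis .
qed

end

section \<open>Isomixtures that are sufficient for a pair\<close>

lemma affine_self_map_map_pmf:
  assumes "g ` X \<subseteq> X"
  shows "affine_self_map X (map_pmf g)"
  using assms by (auto simp: affine_self_map_def prob_on_def map_mix_pmf)

lemma simplex_isometry_involution:
  assumes "\<pi> ` X \<subseteq> X" "\<And>x. \<pi> (\<pi> x) = x"
  shows "simplex_isometry X (map_pmf \<pi>)"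
proof -
  have "map_pmf \<pi> (map_pmf \<pi> P) = P" for P by (simp add: pmf.map_comp o_def assms(2))
  then have "bij_betw (map_pmf \<pi>) (prob_on X) (prob_on X)"
    using assms(1) by (intro bij_betw_byWitness[where f' = "map_pmf \<pi>"]) (auto simp: prob_on_def image_subset_iff subset_iff)
  then show ?thesis by (simp add: simplex_isometry_def affine_self_map_map_pmf[OF assms(1)])
qed

lemma simplex_isometry_transpose:
  assumes "y \<in> X" "z \<in> X"
  shows "simplex_isometry X (map_pmf (Transposition.transpose y z))"
  using assms by (intro simplex_isometry_involution) (auto simp: Transposition.transpose_def)

text \<open>A random transposition, hence an isomixture: \<open>z\<close> becomes distributed as
  \<open>R\<close>, while a point other than \<open>z\<close> outside the support of
  \<open>R\<close> stays fixed.\<close>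

definition spread :: "'a \<Rightarrow> 'a pmf \<Rightarrow> 'a pmf \<Rightarrow> 'a pmf" where
  "spread z R P = bind_pmf R (\<lambda>y. map_pmf (Transposition.transpose z y) P)"

lemma isomixture_spread:
  assumes "finite X" "R \<in> prob_on X" "z \<in> X"
  shows "isomixture X (spread z R)"
  unfolding isomixture_def
proof (intro exI conjI ballI)
  let ?p = "map_pmf (\<lambda>y. map_pmf (Transposition.transpose z y)) R"
  show "finite (set_pmf ?p)" using assms finite_subset by (auto simp: prob_on_def)
  show "simplex_isometry X \<phi>" if "\<phi> \<in> set_pmf ?p" for \<phi>
    using that assms by (auto simp: prob_on_def intro!: simplex_isometry_transpose)
  show "spread z R P = bind_pmf ?p (\<lambda>\<phi>. \<phi> P)" for P
    by (simp add: spread_def bind_map_pmf)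
qed

lemma affine_self_map_spread:
  assumes "R \<in> prob_on X" "z \<in> X"
  shows "affine_self_map X (spread z R)"
  using assms unfolding affine_self_map_def
  by (auto simp: spread_def map_mix_pmf bind_mix_pmf prob_on_def Transposition.transpose_def)

lemma spread_return_same: "spread z R (return_pmf z) = R"
  by (simp add: spread_def bind_return_pmf')

lemma spread_return_other:
  assumes "R \<in> prob_on (X - {x})" "z \<noteq> x"
  shows "spread z R (return_pmf x) = return_pmf x"
proof -
  have "spread z R (return_pmf x) = bind_pmf R (\<lambda>_. return_pmf x)"
    unfolding spread_def using assms
    by (intro bind_pmf_cong refl) (auto simp: prob_on_def Transposition.transpose_def)
  then show ?thesis by simp
qed

lemma isomixture_isometry: "simplex_isometry X \<phi> \<Longrightarrow> isomixture X \<phi>"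
  unfolding isomixture_def by (rule exI[of _ "return_pmf \<phi>"]) (auto simp: bind_return_pmf)

section \<open>The Jensen gap of the maximal growth\<close>

context market
begin

definition gap :: "real \<Rightarrow> (real ^ 'm) pmf \<Rightarrow> (real ^ 'm) pmf \<Rightarrow> real" where
  "gap t P Q = t * max_log_growth P + (1 - t) * max_log_growth Q - max_log_growth (mix_pmf t P Q)"

text \<open>For \<open>b\<close> optimal at the mixture, \<open>log_growth b\<close> is affine and cancels out of the combination
  of regrets on the right.\<close>

lemma gap_eq_regret:
  assumes t: "0 < t" "t < 1" and P: "P \<in> prob_on X" and Q: "Q \<in> prob_on X"
  shows "gap t P Q = t * real_of_ereal (regret P (mix_pmf t P Q))
    + (1 - t) * real_of_ereal (regret Q (mix_pmf t P Q))"
proof -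
  have M: "mix_pmf t P Q \<in> prob_on X" using P Q by (rule mix_pmf_in_prob_on)
  obtain b where b: "b \<in> optimal_portfolios (mix_pmf t P Q)" using optimal_portfolios_nonempty[OF M] .
  have "regret P (mix_pmf t P Q) = ereal (max_log_growth P - log_growth b P)"
       "regret Q (mix_pmf t P Q) = ereal (max_log_growth Q - log_growth b Q)"
    by (intro regret_dominated[OF _ M _ b] P Q; simp add: set_pmf_mix_pmf[OF t])+
  moreover have "max_log_growth (mix_pmf t P Q) = t * log_growth b P + (1 - t) * log_growth b Q"
    using log_growth_optimal[OF M b] t by (simp add: log_growth_mix)
  ultimately show ?thesis by (simp add: gap_def algebra_simps)
qed

lemma gap_0 [simp]: "gap 0 P Q = 0" and gap_1 [simp]: "gap 1 P Q = 0"
  by (simp_all add: gap_def)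

lemma gap_nonneg:
  assumes t: "0 \<le> t" "t \<le> 1" and P: "P \<in> prob_on X" and Q: "Q \<in> prob_on X"
  shows "0 \<le> gap t P Q"
proof (cases "t = 0 \<or> t = 1")
  case True
  then show ?thesis by auto
next
  case False
  then show ?thesis using t gap_eq_regret[OF _ _ P Q, of t] regret_nonneg[OF P] regret_nonneg[OF Q]
    by (auto intro!: add_nonneg_nonneg mult_nonneg_nonneg real_of_ereal_pos)
qed

text \<open>A portfolio optimal for \<open>Q\<close> and within \<open>e\<close> of optimal for
  \<open>P\<close> comes within \<open>e\<close> of the average of the two maxima at the midpoint,
  because \<open>log_growth\<close> is affine. Working up to \<open>e\<close> avoids showing that
  the infimum is attained.\<close>

lemma gap_nonpos_of_regret_0:
  assumes P: "P \<in> prob_on X" and Q: "Q \<in> prob_on X" and r: "regret P Q = 0"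
  shows "gap (1/2) P Q \<le> 0"
proof (rule field_le_epsilon)
  fix e :: real assume e: "0 < e"
  have "(INF b\<in>optimal_portfolios Q. max_growth P - growth b P) < ereal e"
    using r e by (simp add: regret_def)
  then obtain b where b: "b \<in> optimal_portfolios Q" "max_growth P - growth b P < ereal e"
    by (auto simp: INF_less_iff)
  let ?M = "mix_pmf (1/2) P Q"
  note bp = optimal_in_portfolios[OF b(1)]
  have M: "?M \<in> prob_on X" using P Q by (rule mix_pmf_in_prob_on)
  from P bp show "gap (1/2) P Q \<le> 0 + e"
  proof (cases rule: growth_cases)
    case infinite
    then show ?thesis using b(2) max_growth_eq[OF P] by simp
  next
    case finite
    have "0 < x \<bullet> b" if "x \<in> set_pmf ?M" for x
      using that finite(1) inner_optimal_pos[OF Q b(1)] set_pmf_mix_pmf[of "1/2" P Q] by auto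
    then have "log_growth b ?M \<le> max_log_growth ?M" by (rule log_growth_le_max[OF M bp])
    then have "log_growth b P / 2 + max_log_growth Q / 2 \<le> max_log_growth ?M"
      using log_growth_optimal[OF Q b(1)] by (simp add: log_growth_mix)
    moreover have "max_log_growth P < log_growth b P + e"
      using b(2) finite(2) max_growth_eq[OF P] by simp
    ultimately show ?thesis using e by (simp add: gap_def)
  qed
qed

text \<open>By affinity the recovery map also restores the mixture, so sufficiency for the two ends
  extends to each end paired with the mixture. These are the pairs whose regrets make up the
  gap.\<close>

lemma gap_sufficient:
  assumes iso: "iso_sufficiency X regret" and \<Phi>: "isomixture X \<Phi>" "affine_self_map X \<Phi>"
    and \<Psi>: "affine_self_map X \<Psi>" "\<Psi> (\<Phi> P) = P" "\<Psi> (\<Phi> Q) = Q"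
    and P: "P \<in> prob_on X" and Q: "Q \<in> prob_on X" and t: "0 \<le> t" "t \<le> 1"
  shows "gap t (\<Phi> P) (\<Phi> Q) = gap t P Q"
proof (cases "t = 0 \<or> t = 1")
  case True
  then show ?thesis by auto
next
  case False
  then have t': "0 < t" "t < 1" using t by auto
  let ?M = "mix_pmf t P Q"
  have M: "?M \<in> prob_on X" using P Q by (rule mix_pmf_in_prob_on)
  have \<Phi>in: "\<Phi> P \<in> prob_on X" "\<Phi> Q \<in> prob_on X" using \<Phi>(2) P Q by (auto simp: affine_self_map_def)
  have \<Phi>M: "\<Phi> ?M = mix_pmf t (\<Phi> P) (\<Phi> Q)" using \<Phi>(2) P Q t by (auto simp: affine_self_map_def)
  have \<Psi>M: "\<Psi> (\<Phi> ?M) = ?M" unfolding \<Phi>M using \<Psi> \<Phi>in t by (auto simp: affine_self_map_def)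
  have "regret (\<Phi> P) (\<Phi> ?M) = regret P ?M" "regret (\<Phi> Q) (\<Phi> ?M) = regret Q ?M"
    using iso P Q M \<Phi> \<Psi> \<Psi>M unfolding iso_sufficiency_def sufficient_for_def by blast+
  then show ?thesis
    using gap_eq_regret[OF t' P Q] gap_eq_regret[OF t' \<Phi>in] by (simp add: \<Phi>M)
qed

lemma gap_spread:
  assumes iso: "iso_sufficiency X regret" and xz: "x \<in> X" "z \<in> X" "x \<noteq> z"
    and R: "R \<in> prob_on (X - {x})" and t: "0 \<le> t" "t \<le> 1"
  shows "gap t (return_pmf x) R = gap t (return_pmf x) (return_pmf z)"
proof -
  have R': "R \<in> prob_on X" using R by (rule prob_on_mono) auto
  \<comment> \<open>Collapsing everything except \<open>x\<close> onto \<open>z\<close> undoes the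
    spreading of \<open>z\<close> and keeps \<open>x\<close>.\<close>
  define \<Psi> where "\<Psi> = map_pmf (\<lambda>w. if w = x then x else z)"
  have \<Psi>: "affine_self_map X \<Psi>" unfolding \<Psi>_def by (rule affine_self_map_map_pmf) (use xz in auto)
  have \<Phi>x: "spread z R (return_pmf x) = return_pmf x" using spread_return_other[OF R] xz by auto
  have "\<Psi> R = map_pmf (\<lambda>_. z) R"
    unfolding \<Psi>_def using R by (intro map_pmf_cong) (auto simp: prob_on_def)
  then have "\<Psi> R = return_pmf z" by simp
  then have "gap t (spread z R (return_pmf x)) (spread z R (return_pmf z)) = gap t (return_pmf x) (return_pmf z)"
    using xz R' \<Phi>x
    by (intro gap_sufficient[OF iso isomixture_spread[OF finite_X] affine_self_map_spread \<Psi>] t return_pmf_in_prob_on)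
      (auto simp: spread_return_same \<Psi>_def)
  then show ?thesis by (simp add: \<Phi>x spread_return_same)
qed

lemma gap_swap:
  assumes iso: "iso_sufficiency X regret" and xz: "x \<in> X" "z \<in> X" and t: "0 \<le> t" "t \<le> 1"
  shows "gap t (return_pmf x) (return_pmf z) = gap t (return_pmf z) (return_pmf x)"
proof -
  define \<Phi> where "\<Phi> = map_pmf (Transposition.transpose x z)"
  have i: "simplex_isometry X \<Phi>" unfolding \<Phi>_def using xz by (rule simplex_isometry_transpose)
  have a: "affine_self_map X \<Phi>" using i by (simp add: simplex_isometry_def)
  have "gap t (\<Phi> (return_pmf z)) (\<Phi> (return_pmf x)) = gap t (return_pmf z) (return_pmf x)"
    using xz t by (intro gap_sufficient[OF iso isomixture_isometry[OF i] a a])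
      (auto simp: \<Phi>_def return_pmf_in_prob_on)
  then show ?thesis by (simp add: \<Phi>_def)
qed

text \<open>\<open>gap_spread\<close> with a point mass moves the second end of an edge and
  \<open>gap_swap\<close> exchanges the ends. The case split keeps the two ends distinct along the
  way.\<close>

lemma gap_vertices:
  assumes iso: "iso_sufficiency X regret" and t: "0 \<le> t" "t \<le> 1"
    and xz: "x \<in> X" "z \<in> X" "x \<noteq> z" and yw: "y \<in> X" "w \<in> X" "y \<noteq> w"
  shows "gap t (return_pmf x) (return_pmf z) = gap t (return_pmf y) (return_pmf w)"
proof -
  have move: "gap t (return_pmf x) (return_pmf z) = gap t (return_pmf x) (return_pmf w)"
    if "x \<in> X" "z \<in> X" "x \<noteq> z" "w \<in> X" "x \<noteq> w" for x z w
    using that by (intro gap_spread[OF iso _ _ _ _ t]) (auto simp: prob_on_def)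
  note swap = gap_swap[OF iso _ _ t]
  show ?thesis
  proof (cases "z = y")
    case True
    then show ?thesis using swap[OF xz(1,2)] move[of y x w] xz yw by simp
  next
    case False
    then show ?thesis
      using swap[OF xz(1,2)] move[of z x y] swap[OF xz(2) yw(1)] move[of y z w] xz yw by simp
  qed
qed

section \<open>Sufficiency forces strict convexity\<close>

text \<open>\<open>f\<close> is minus the Jensen gap of an edge; which edge is taken does not matter
  by \<open>gap_vertices\<close>.\<close>

lemma chain_rule:
  assumes iso: "iso_sufficiency X regret" and "2 \<le> card X"
  obtains f :: "real \<Rightarrow> real" where
    "\<And>t x R. \<lbrakk>0 \<le> t; t \<le> 1; x \<in> X; R \<in> prob_on (X - {x})\<rbrakk> \<Longrightarrow>
      max_log_growth (mix_pmf t (return_pmf x) R)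
        = f t + t * max_log_growth (return_pmf x) + (1 - t) * max_log_growth R"
proof -
  obtain y w where yw: "y \<in> X" "w \<in> X" "y \<noteq> w"
    using assms(2) card_le_Suc0_iff_eq[OF finite_X] by fastforce
  show ?thesis
  proof (rule that[of "\<lambda>t. - gap t (return_pmf y) (return_pmf w)"])
    fix t x R assume t: "0 \<le> t" "t \<le> (1::real)" and x: "x \<in> X" and R: "R \<in> prob_on (X - {x})"
    obtain z where z: "z \<in> X" "x \<noteq> z" using yw by metis
    have "gap t (return_pmf x) R = gap t (return_pmf y) (return_pmf w)"
      using gap_spread[OF iso x z R t] gap_vertices[OF iso t x z yw] by simp
    then show "max_log_growth (mix_pmf t (return_pmf x) R) = - gap t (return_pmf y) (return_pmf w)
      + t * max_log_growth (return_pmf x) + (1 - t) * max_log_growth R"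
      by (simp add: gap_def)
  qed
qed

text \<open>A portfolio optimal for the uniform distribution falls short of the best growth by a
  nonnegative amount at each vertex, and these amounts average to zero. It is thus optimal at every
  vertex and, by affinity, for every distribution.\<close>

lemma regret_0_of_affine:
  assumes aff: "\<And>P. P \<in> prob_on X \<Longrightarrow> max_log_growth P = (\<Sum>x\<in>X. pmf P x * max_log_growth (return_pmf x))"
    and P: "P \<in> prob_on X" and Q: "Q \<in> prob_on X"
  shows "regret P Q = 0"
proof -
  have ne: "X \<noteq> {}" using P set_pmf_not_empty[of P] by (auto simp: prob_on_def)
  define U where "U = pmf_of_set X"
  have sU: "set_pmf U = X" and pU: "\<And>x. x \<in> X \<Longrightarrow> pmf U x = 1 / card X"
    using ne finite_X by (auto simp: U_def)
  have U: "U \<in> prob_on X" by (simp add: prob_on_def sU)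
  obtain b where b: "b \<in> optimal_portfolios U" using optimal_portfolios_nonempty[OF U] .
  note bp = optimal_in_portfolios[OF b]
  have pos: "0 < x \<bullet> b" if "x \<in> X" for x using inner_optimal_pos[OF U b] that sU by auto
  have le: "ln (x \<bullet> b) \<le> max_log_growth (return_pmf x)" if x: "x \<in> X" for x
  proof -
    have "log_growth b (return_pmf x) = ln (x \<bullet> b)"
      using x by (simp add: log_growth_support return_pmf_in_prob_on)
    then show ?thesis
      using log_growth_le_max[OF return_pmf_in_prob_on[OF x] bp] pos[OF x] by simp
  qed
  have "(\<Sum>x\<in>X. pmf U x * ln (x \<bullet> b)) = (\<Sum>x\<in>X. pmf U x * max_log_growth (return_pmf x))"
    using log_growth_optimal[OF U b] aff[OF U] by (simp add: log_growth_def)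
  then have "\<forall>x\<in>X. pmf U x * max_log_growth (return_pmf x) - pmf U x * ln (x \<bullet> b) = 0"
    using le finite_X
    by (subst sum_nonneg_eq_0_iff[symmetric]) (auto simp: sum_subtractf intro!: mult_left_mono)
  then have eq: "ln (x \<bullet> b) = max_log_growth (return_pmf x)" if "x \<in> X" for x
    using that pU[OF that] finite_X ne by (auto simp: right_diff_distrib[symmetric])
  have opt: "b \<in> optimal_portfolios P'" if P': "P' \<in> prob_on X" for P'
  proof (rule optimalI[OF P' bp])
    show "0 < x \<bullet> b" if "x \<in> set_pmf P'" for x using pos in_X[OF P' that] .
    have "log_growth b P' = max_log_growth P'" using eq aff[OF P'] by (simp add: log_growth_def)
    then show "log_growth c P' \<le> log_growth b P'"
      if "c \<in> portfolios" "\<And>x. x \<in> set_pmf P' \<Longrightarrow> 0 < x \<bullet> c" for c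
      using log_growth_le_max[OF P' that] by simp
  qed
  show ?thesis using regret_eq_0[OF P opt[OF P] opt[OF Q]] .
qed

text \<open>The distribution with weights \<open>a\<close>, \<open>b\<close>, \<open>c\<close> can
  be split at \<open>x\<close> first or at \<open>z\<close> first. In the two resulting chain rules
  the vertex terms agree and cancel.\<close>

lemma functional_equation:
  fixes f :: "real \<Rightarrow> real"
  assumes chain: "\<And>t x R. \<lbrakk>0 \<le> t; t \<le> 1; x \<in> X; R \<in> prob_on (X - {x})\<rbrakk> \<Longrightarrow>
      max_log_growth (mix_pmf t (return_pmf x) R)
        = f t + t * max_log_growth (return_pmf x) + (1 - t) * max_log_growth R"
    and xyz: "x \<in> X" "y \<in> X" "z \<in> X" "x \<noteq> y" "y \<noteq> z" "x \<noteq> z"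
    and abc: "0 < a" "0 < b" "0 < c" "a + b + c = 1"
  shows "f a + (1 - a) * f (b / (1 - a)) = f c + (1 - c) * f (a / (1 - c))"
proof -
  have a1: "1 - a = b + c" and c1: "1 - c = a + b" using abc by auto
  define t s where "t = b / (b + c)" and "s = a / (a + b)"
  have ts: "0 \<le> t" "t \<le> 1" "0 \<le> s" "s \<le> 1" using abc by (auto simp: t_def s_def)
  have t1: "(b + c) * t = b" "(b + c) * (1 - t) = c" and s1: "(a + b) * s = a" "(a + b) * (1 - s) = b"
    using abc by (auto simp: t_def s_def field_simps)
  let ?l = "mix_pmf t (return_pmf y) (return_pmf z)" and ?r = "mix_pmf s (return_pmf x) (return_pmf y)"
  have in_prob: "?l \<in> prob_on (X - {x})" "?r \<in> prob_on (X - {z})"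
    using xyz by (auto intro!: mix_pmf_in_prob_on return_pmf_in_prob_on)
  have "mix_pmf a (return_pmf x) ?l = mix_pmf c (return_pmf z) ?r"
  proof (rule pmf_eqI)
    fix w
    have "pmf (mix_pmf a (return_pmf x) ?l) w = a * indicator {w} x + (b + c) * t * indicator {w} y + (b + c) * (1 - t) * indicator {w} z"
      using abc ts by (simp add: pmf_mix_pmf a1 algebra_simps)
    moreover have "pmf (mix_pmf c (return_pmf z) ?r) w = c * indicator {w} z + (a + b) * s * indicator {w} x + (a + b) * (1 - s) * indicator {w} y"
      using abc ts by (simp add: pmf_mix_pmf c1 algebra_simps)
    ultimately show "pmf (mix_pmf a (return_pmf x) ?l) w = pmf (mix_pmf c (return_pmf z) ?r) w"
      by (simp add: t1 s1)
  qed
  then have "f a + a * max_log_growth (return_pmf x) + (b + c) * max_log_growth ?l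
      = f c + c * max_log_growth (return_pmf z) + (a + b) * max_log_growth ?r"
    using chain[OF _ _ xyz(1) in_prob(1), of a] chain[OF _ _ xyz(3) in_prob(2), of c] abc by (simp add: a1 c1)
  moreover have "max_log_growth ?l = f t + t * max_log_growth (return_pmf y) + (1 - t) * max_log_growth (return_pmf z)"
    using ts xyz by (intro chain) (auto intro!: return_pmf_in_prob_on)
  then have "(b + c) * max_log_growth ?l = (b + c) * f t + (b + c) * t * max_log_growth (return_pmf y)
      + (b + c) * (1 - t) * max_log_growth (return_pmf z)" by (simp only: distrib_left mult.assoc)
  moreover have "max_log_growth ?r = f s + s * max_log_growth (return_pmf x) + (1 - s) * max_log_growth (return_pmf y)"
    using ts xyz by (intro chain) (auto intro!: return_pmf_in_prob_on)
  then have "(a + b) * max_log_growth ?r = (a + b) * f s + (a + b) * s * max_log_growth (return_pmf x)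
      + (a + b) * (1 - s) * max_log_growth (return_pmf y)" by (simp only: distrib_left mult.assoc)
  ultimately show ?thesis unfolding a1 c1 t_def[symmetric] s_def[symmetric] t1 s1 by linarith
qed

lemma max_log_growth_mix_le:
  assumes "0 \<le> t" "t \<le> 1" "P \<in> prob_on X" "Q \<in> prob_on X"
  shows "max_log_growth (mix_pmf t P Q) \<le> t * max_log_growth P + (1 - t) * max_log_growth Q"
  using gap_nonneg[OF assms] by (simp add: gap_def)

lemma sufficiency_imp_separation:
  assumes iso: "iso_sufficiency X regret" and three: "3 \<le> card X"
    and nontrivial: "P\<^sub>0 \<in> prob_on X" "Q\<^sub>0 \<in> prob_on X" "regret P\<^sub>0 Q\<^sub>0 \<noteq> 0"
    and P: "P \<in> prob_on X" and Q: "Q \<in> prob_on X" and r0: "regret P Q = 0"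
  shows "P = Q"
proof (rule ccontr)
  assume "P \<noteq> Q"
  let ?G = max_log_growth
  obtain f where chain: "\<And>t x R. \<lbrakk>0 \<le> t; t \<le> 1; x \<in> X; R \<in> prob_on (X - {x})\<rbrakk> \<Longrightarrow>
      ?G (mix_pmf t (return_pmf x) R) = f t + t * ?G (return_pmf x) + (1 - t) * ?G R"
    using chain_rule[OF iso] three by auto
  obtain V where "V \<subseteq> X" "card V = 3" using obtain_subset_with_card_n[OF three] by blast
  then obtain x y z where xyz: "x \<in> X" "y \<in> X" "z \<in> X" "x \<noteq> y" "y \<noteq> z" "x \<noteq> z"
    by (auto simp: card_3_iff)
  \<comment> \<open>Along any edge \<open>f\<close> is \<open>?G\<close> minus its chord, from which
    it inherits its end values, symmetry and convexity.\<close>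
  have f_edge: "f t = ?G (mix_pmf t (return_pmf v) (return_pmf w)) - t * ?G (return_pmf v) - (1 - t) * ?G (return_pmf w)"
    if "0 \<le> t" "t \<le> 1" "v \<in> X" "w \<in> X" "v \<noteq> w" for t v w
    using chain[OF that(1-3), of "return_pmf w"] that by (simp add: return_pmf_in_prob_on)
  have f01: "f 0 = 0" "f 1 = 0" using f_edge[of 0 x y] f_edge[of 1 x y] xyz by auto
  have sym: "f (1 - t) = f t" if "0 \<le> t" "t \<le> 1" for t
    using f_edge[of t x y] f_edge[of "1 - t" y x] mix_pmf_commute[OF that, of "return_pmf x" "return_pmf y"] that xyz
    by simp
  have cvx: "convex_on {0..1} f"
  proof (rule convex_onI)
    fix t u v :: real assume t: "0 < t" "t < 1" and uv: "u \<in> {0..1}" "v \<in> {0..1}"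
    define m where "m = (1 - t) * u + t * v"
    have m: "m \<in> {0..1}"
      using convexD[OF convex_real_interval(5)[of 0 1] uv, of "1 - t" t] t by (simp add: m_def)
    define E where "E u = mix_pmf u (return_pmf x) (return_pmf y)" for u
    have E: "E u \<in> prob_on X" for u
      using xyz by (simp add: E_def mix_pmf_in_prob_on return_pmf_in_prob_on)
    have "E m = mix_pmf (1 - t) (E u) (E v)"
      using t uv m by (intro pmf_eqI) (simp add: E_def pmf_mix_pmf, simp add: m_def algebra_simps)
    then have "?G (E m) \<le> (1 - t) * ?G (E u) + t * ?G (E v)"
      using max_log_growth_mix_le[of "1 - t" "E u" "E v"] E t by simp
    then have "f m \<le> (1 - t) * f u + t * f v"
      using f_edge[of m x y] f_edge[of u x y] f_edge[of v x y] xyz uv m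
      by (simp add: E_def[symmetric]) (simp add: m_def algebra_simps)
    then show "f ((1 - t) *\<^sub>R u + t *\<^sub>R v) \<le> (1 - t) * f u + t * f v" by (simp add: m_def)
  qed simp
  \<comment> \<open>\<open>P\<close> and \<open>Q\<close> are both split at a vertex where their
    masses differ, so that the defect of strict convexity can be located in \<open>f\<close> between
    \<open>p\<close> and \<open>q\<close>.\<close>
  obtain x where x: "pmf P x \<noteq> pmf Q x" using \<open>P \<noteq> Q\<close> by (meson pmf_eqI)
  have xX: "x \<in> X" using x pmf_eq_0_outside P Q by metis
  have ne: "X - {x} \<noteq> {}" using xyz(2,3,5) by blast
  define p q where "p = pmf P x" and "q = pmf Q x"
  have pq: "p \<noteq> q" "0 \<le> p" "p \<le> 1" "0 \<le> q" "q \<le> 1" using x by (auto simp: p_def q_def pmf_le_1)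
  obtain R where R: "R \<in> prob_on (X - {x})" "P = mix_pmf p (return_pmf x) R"
    using pmf_split_point[OF P finite_X ne] unfolding p_def by metis
  obtain S where S: "S \<in> prob_on (X - {x})" "Q = mix_pmf q (return_pmf x) S"
    using pmf_split_point[OF Q finite_X ne] unfolding q_def by metis
  \<comment> \<open>The midpoint of \<open>P\<close> and \<open>Q\<close> has mass
    \<open>d / 2\<close> off \<open>x\<close>, shared by \<open>R\<close> and \<open>S\<close> in
    the proportion \<open>1 - p\<close> to \<open>1 - q\<close>. Here \<open>d\<close> is positive
    because \<open>p\<close> and \<open>q\<close> differ.\<close>
  define d s where "d = 2 - p - q" and "s = (1 - p) / d"
  have d: "0 < d" using pq by (auto simp: d_def)
  have s: "0 \<le> s" "s \<le> 1" using pq d by (auto simp: s_def) (simp add: d_def)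
  have "d * s = 1 - p" using d by (simp add: s_def)
  then have sd: "d * s = 1 - p" "d * (1 - s) = 1 - q" unfolding right_diff_distrib by (simp_all add: d_def)
  define m where "m = (p + q) / 2"
  have m: "0 \<le> m" "m \<le> 1" and m1: "1 - m = d / 2" using pq by (auto simp: m_def d_def field_simps)
  have RS: "R \<in> prob_on X" "S \<in> prob_on X" "mix_pmf s R S \<in> prob_on (X - {x})"
    using R(1) S(1) by (auto intro: prob_on_mono mix_pmf_in_prob_on)
  have "mix_pmf (1/2) P Q = mix_pmf m (return_pmf x) (mix_pmf s R S)"
  proof (rule pmf_eqI)
    fix w
    have "pmf (mix_pmf m (return_pmf x) (mix_pmf s R S)) w
        = m * pmf (return_pmf x) w + (d * s) * pmf R w / 2 + (d * (1 - s)) * pmf S w / 2"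
      using m s by (simp add: pmf_mix_pmf m1) (simp add: algebra_simps)
    also have "\<dots> = pmf (mix_pmf (1/2) P Q) w"
      using pq by (simp add: R(2) S(2) pmf_mix_pmf sd) (simp add: m_def field_simps)
    finally show "pmf (mix_pmf (1/2) P Q) w = pmf (mix_pmf m (return_pmf x) (mix_pmf s R S)) w" by simp
  qed
  \<comment> \<open>Convexity of \<open>?G\<close> bounds the contribution of \<open>R\<close> and
    \<open>S\<close>. Compared with the chain rules for \<open>P\<close> and \<open>Q\<close>, only
    values of \<open>f\<close> remain, and zero regret forces equality in its midpoint
    inequality.\<close>
  then have "?G (mix_pmf (1/2) P Q) = f m + m * ?G (return_pmf x) + d / 2 * ?G (mix_pmf s R S)"
    using chain[OF m xX RS(3)] m1 by simp
  also have "d / 2 * ?G (mix_pmf s R S) \<le> d / 2 * (s * ?G R + (1 - s) * ?G S)"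
    using max_log_growth_mix_le[OF s RS(1,2)] d by (intro mult_left_mono) auto
  also have "\<dots> = ((1 - p) * ?G R + (1 - q) * ?G S) / 2"
    unfolding sd[symmetric] by (simp add: field_simps)
  finally have "2 * ?G (mix_pmf (1/2) P Q) \<le> 2 * f m + (p + q) * ?G (return_pmf x) + (1 - p) * ?G R + (1 - q) * ?G S"
    by (simp add: m_def field_simps)
  moreover have "?G P = f p + p * ?G (return_pmf x) + (1 - p) * ?G R"
    "?G Q = f q + q * ?G (return_pmf x) + (1 - q) * ?G S"
    using chain[OF _ _ xX R(1), of p] chain[OF _ _ xX S(1), of q] pq R(2) S(2) by auto
  moreover have "?G P + ?G Q \<le> 2 * ?G (mix_pmf (1/2) P Q)"
    using gap_nonpos_of_regret_0[OF P Q r0] by (simp add: gap_def)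
  ultimately have "f p + f q \<le> 2 * f m" by (simp add: algebra_simps)
  moreover have "2 * f m \<le> f p + f q"
    using convex_onD[OF cvx, of "1/2" p q] pq by (simp add: m_def add_divide_distrib)
  ultimately have mid: "f ((p + q) / 2) = (f p + f q) / 2" by (simp add: m_def)
  have "f t = 0" if "0 < t" "t < 1" for t
  proof (cases "p < q")
    case True
    show ?thesis
      by (rule entropy_equation_rigidity[OF cvx sym functional_equation[OF chain xyz] pq(2) True pq(5) mid that])
  next
    case False
    then have lt: "q < p" using pq(1) by simp
    have mid': "f ((q + p) / 2) = (f q + f p) / 2" using mid by (simp add: add.commute)
    show ?thesis
      by (rule entropy_equation_rigidity[OF cvx sym functional_equation[OF chain xyz] pq(4) lt pq(3) mid' that])
  qed
  then have f0: "f t = 0" if "0 \<le> t" "t \<le> 1" for t using f01 that by (cases "t = 0 \<or> t = 1") auto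
  \<comment> \<open>With \<open>f\<close> zero the chain rule makes \<open>?G\<close> affine, so the
    regret would vanish identically, against \<open>nontrivial\<close>.\<close>
  have "?G P' = (\<Sum>x\<in>X. pmf P' x * ?G (return_pmf x))" if "P' \<in> prob_on X" for P'
    using finite_X that
  proof (induction rule: prob_on_induct)
    case (return x)
    then show ?case using finite_X by (simp add: indicator_def if_distrib[of "\<lambda>u. u * _"] cong: if_cong)
  next
    case (mix t x R)
    have "(\<Sum>w\<in>X. pmf (return_pmf x) w * ?G (return_pmf w)) = ?G (return_pmf x)"
      using finite_X mix by (simp add: indicator_def if_distrib[of "\<lambda>u. u * _"] cong: if_cong)
    moreover have "(\<Sum>w\<in>X. pmf (mix_pmf t (return_pmf x) R) w * ?G (return_pmf w)) =
       t * (\<Sum>w\<in>X. pmf (return_pmf x) w * ?G (return_pmf w)) + (1 - t) * (\<Sum>w\<in>X. pmf R w * ?G (return_pmf w))"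
      unfolding sum_distrib_left sum.distrib[symmetric] using mix
      by (intro sum.cong) (auto simp: pmf_mix_pmf algebra_simps)
    ultimately show ?case using chain[of t x R] f0[of t] mix by simp
  qed
  then have "regret P\<^sub>0 Q\<^sub>0 = 0" by (rule regret_0_of_affine[OF _ nontrivial(1,2)])
  then show False using nontrivial(3) by simp
qed

end

section \<open>Data processing for the Kullback-Leibler divergence\<close>

lemma pmf_bind_prob_on:
  assumes "finite X" "P \<in> prob_on X"
  shows "pmf (bind_pmf P K) y = (\<Sum>x\<in>X. pmf P x * pmf (K x) y)"
  unfolding pmf_bind using assms
  by (subst integral_measure_pmf_real[where A = X]) (auto simp: prob_on_def mult.commute)

lemma kl_data_processing:
  assumes X: "finite X" and P: "P \<in> prob_on X" and Q: "Q \<in> prob_on X"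
    and sub: "set_pmf P \<subseteq> set_pmf Q" and K: "\<And>x. x \<in> X \<Longrightarrow> K x \<in> prob_on X"
  defines "P' \<equiv> bind_pmf P K" and "Q' \<equiv> bind_pmf Q K"
  shows "(\<Sum>y\<in>X. pmf P' y * ln (pmf P' y / pmf Q' y)) \<le> (\<Sum>x\<in>X. pmf P x * ln (pmf P x / pmf Q x))"
proof -
  have P': "pmf P' y = (\<Sum>x\<in>X. pmf P x * pmf (K x) y)" and Q': "pmf Q' y = (\<Sum>x\<in>X. pmf Q x * pmf (K x) y)" for y
    unfolding P'_def Q'_def using P Q X by (simp_all add: pmf_bind_prob_on)
  have P'in: "P' \<in> prob_on X" using P K by (auto simp: P'_def prob_on_def)
  have le: "pmf P x * pmf (K x) y * ln (pmf P' y / pmf Q' y) - pmf P x * pmf (K x) y * ln (pmf P x / pmf Q x)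
      \<le> pmf P' y / pmf Q' y * (pmf Q x * pmf (K x) y) - pmf P x * pmf (K x) y" if x: "x \<in> X" for x y
  proof (cases "pmf P x * pmf (K x) y = 0")
    case True
    then show ?thesis by (simp add: True)
  next
    case False
    then have pos: "0 < pmf P x" "0 < pmf (K x) y" by (auto simp: less_le)
    then have "x \<in> set_pmf P" by (simp add: set_pmf_iff)
    then have "x \<in> set_pmf Q" using sub by blast
    then have posQ: "0 < pmf Q x" by (rule pmf_positive)
    have "y \<in> set_pmf P'" "y \<in> set_pmf Q'"
      using pos posQ by (auto simp: P'_def Q'_def set_pmf_iff intro!: bexI[of _ x])
    then have pos': "0 < pmf P' y" "0 < pmf Q' y" by (auto intro: pmf_positive)
    \<comment> \<open>The likelihood ratio after the kernel divided by the one before it;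
      \<open>ln r \<le> r - 1\<close> gives the termwise bound.\<close>
    define r where "r = pmf P' y / pmf Q' y / (pmf P x / pmf Q x)"
    have r: "0 < r" using pos posQ pos' by (simp add: r_def)
    have "ln (pmf P' y / pmf Q' y) - ln (pmf P x / pmf Q x) = ln r"
      using pos posQ pos' by (simp add: r_def ln_div ln_mult)
    also have "\<dots> \<le> r - 1" using r by (rule ln_le_minus_one)
    finally have "pmf P x * pmf (K x) y * (ln (pmf P' y / pmf Q' y) - ln (pmf P x / pmf Q x))
        \<le> pmf P x * pmf (K x) y * (r - 1)" by (rule mult_left_mono) simp
    also have "\<dots> = pmf P' y / pmf Q' y * (pmf Q x * pmf (K x) y) - pmf P x * pmf (K x) y"
      using pos posQ pos' by (simp add: r_def field_simps)
    finally show ?thesis by (simp add: right_diff_distrib)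
  qed
  \<comment> \<open>Each row of the kernel has mass one, which turns both divergences into double
    sums over the same pairs.\<close>
  have row: "(\<Sum>y\<in>X. pmf P x * pmf (K x) y * c) = pmf P x * c" if "x \<in> X" for x c
    using sum_pmf_prob_on[OF X K[OF that]] by (simp add: sum_distrib_right[symmetric] sum_distrib_left[symmetric])
  have "(\<Sum>y\<in>X. pmf P' y * ln (pmf P' y / pmf Q' y)) - (\<Sum>x\<in>X. pmf P x * ln (pmf P x / pmf Q x))
      = (\<Sum>y\<in>X. \<Sum>x\<in>X. pmf P x * pmf (K x) y * ln (pmf P' y / pmf Q' y))
        - (\<Sum>x\<in>X. \<Sum>y\<in>X. pmf P x * pmf (K x) y * ln (pmf P x / pmf Q x))"
    by (intro arg_cong2[where f = minus] sum.cong refl) (simp_all only: row, simp_all add: P' sum_distrib_right)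
  also have "\<dots> = (\<Sum>y\<in>X. \<Sum>x\<in>X. pmf P x * pmf (K x) y * ln (pmf P' y / pmf Q' y)
        - pmf P x * pmf (K x) y * ln (pmf P x / pmf Q x))"
    by (subst (2) sum.swap) (simp add: sum_subtractf)
  also have "\<dots> \<le> (\<Sum>y\<in>X. \<Sum>x\<in>X. pmf P' y / pmf Q' y * (pmf Q x * pmf (K x) y) - pmf P x * pmf (K x) y)"
    by (intro sum_mono le)
  also have "\<dots> = (\<Sum>y\<in>X. pmf P' y / pmf Q' y * pmf Q' y - pmf P' y)"
    by (simp add: sum_subtractf P' Q' sum_distrib_left)
  \<comment> \<open>A term is zero where \<open>Q'\<close> has mass; elsewhere division by zero
    yields zero and leaves minus the mass of \<open>P'\<close>.\<close>
  also have "\<dots> \<le> 0" by (rule sum_nonpos) simp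
  finally show ?thesis by simp
qed

section \<open>Separation forces proportional betting\<close>

context market
begin

text \<open>The Kuhn-Tucker condition for staking everything on \<open>i\<close>: with masses
  proportional to \<open>w x * x $ i\<close>, the ratio of the return of any \<open>c\<close> to
  that of asset \<open>i\<close> has mean at most 1, because asset \<open>i\<close> has the largest
  weighted total. Then \<open>ln r \<le> r - 1\<close> applies.\<close>

lemma axis_optimal:
  assumes P: "P \<in> prob_on X" and w: "\<And>x. x \<in> X \<Longrightarrow> 0 < w x"
    and max: "\<And>l. (\<Sum>x\<in>X. w x * x $ l) \<le> (\<Sum>x\<in>X. w x * x $ i)"
    and T: "0 < (\<Sum>x\<in>X. w x * x $ i)"
    and pmf: "\<And>x. x \<in> X \<Longrightarrow> pmf P x = w x * x $ i / (\<Sum>x\<in>X. w x * x $ i)"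
  shows "axis i 1 \<in> optimal_portfolios P"
proof (rule optimalI[OF P axis_in_portfolios])
  let ?T = "\<Sum>x\<in>X. w x * x $ i"
  have pos: "0 < x $ i" if x: "x \<in> set_pmf P" for x
    using nonneg[OF in_X[OF P x], of i] pmf[OF in_X[OF P x]] pmf_positive[OF x] by (cases "x $ i = 0") auto
  then show "0 < x \<bullet> axis i 1" if "x \<in> set_pmf P" for x using that by (simp add: inner_axis)
  fix c :: "real ^ 'm" assume c: "c \<in> portfolios" "\<And>x. x \<in> set_pmf P \<Longrightarrow> 0 < x \<bullet> c"
  have "log_growth c P - log_growth (axis i 1) P = (\<Sum>x\<in>X. pmf P x * (ln (x \<bullet> c) - ln (x $ i)))"
    by (simp add: log_growth_def inner_axis sum_subtractf right_diff_distrib)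
  also have "\<dots> \<le> (\<Sum>x\<in>X. w x * (x \<bullet> c) / ?T - pmf P x)"
  proof (rule sum_mono)
    fix x assume x: "x \<in> X"
    show "pmf P x * (ln (x \<bullet> c) - ln (x $ i)) \<le> w x * (x \<bullet> c) / ?T - pmf P x"
    proof (cases "x \<in> set_pmf P")
      case True
      have "ln (x \<bullet> c) - ln (x $ i) \<le> x \<bullet> c / x $ i - 1"
        using ln_le_minus_one[of "x \<bullet> c / x $ i"] c(2)[OF True] pos[OF True] by (simp add: ln_div)
      then have "pmf P x * (ln (x \<bullet> c) - ln (x $ i)) \<le> pmf P x * (x \<bullet> c / x $ i - 1)"
        by (rule mult_left_mono) simp
      also have "\<dots> = w x * (x \<bullet> c) / ?T - pmf P x"
        using pos[OF True] by (simp add: pmf[OF x] right_diff_distrib)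
      finally show ?thesis .
    next
      case False
      then show ?thesis using w[OF x] inner_nonneg[OF x c(1)] T by (simp add: set_pmf_iff)
    qed
  qed
  also have "\<dots> = (\<Sum>x\<in>X. w x * (x \<bullet> c)) / ?T - 1"
    by (simp add: sum_subtractf sum_pmf_prob_on[OF finite_X P] sum_divide_distrib)
  also have "(\<Sum>x\<in>X. w x * (x \<bullet> c)) = (\<Sum>l\<in>UNIV. c $ l * (\<Sum>x\<in>X. w x * x $ l))"
    unfolding inner_vec_def sum_distrib_left by (subst sum.swap) (simp add: mult_ac)
  also have "\<dots> \<le> (\<Sum>l\<in>UNIV. c $ l * ?T)"
    using c(1) by (intro sum_mono mult_left_mono max) (simp add: portfolios_def)
  also have "\<dots> = ?T" using c(1) by (simp add: sum_distrib_right[symmetric] portfolios_def)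
  finally show "log_growth c P \<le> log_growth (axis i 1) P" using T by (simp add: divide_right_mono)
qed

text \<open>An asset paying in two states would remain optimal when the weights \<open>w\<close> are perturbed in the
  direction \<open>v\<close>, while the distribution for which it is optimal changes.\<close>

lemma dominant_asset_single_state:
  assumes sep: "\<And>P Q. \<lbrakk>P \<in> prob_on X; Q \<in> prob_on X; regret P Q = 0\<rbrakk> \<Longrightarrow> P = Q"
    and w: "\<And>x. x \<in> X \<Longrightarrow> 0 < w x" and v: "\<And>x. 0 \<le> v x" "inj_on v X"
    and max: "\<And>l. (\<Sum>x\<in>X. w x * x $ l) \<le> (\<Sum>x\<in>X. w x * x $ i)"
    and tie: "\<And>l. (\<Sum>x\<in>X. w x * x $ l) = (\<Sum>x\<in>X. w x * x $ i) \<Longrightarrow>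
      (\<Sum>x\<in>X. w x * v x * x $ l) \<le> (\<Sum>x\<in>X. w x * v x * x $ i)"
    and xy: "x \<in> X" "y \<in> X" "0 < x $ i" "0 < y $ i"
  shows "x = y"
proof -
  define S V where "S l = (\<Sum>x\<in>X. w x * x $ l)" and "V l = (\<Sum>x\<in>X. w x * v x * x $ l)" for l
  have "\<forall>\<^sub>F e in at_right 0. S l + e * V l \<le> S i + e * V i" for l
  \<comment> \<open>Ties are settled by \<open>tie\<close>, and an asset strictly behind stays
    behind for small \<open>e\<close> by continuity. There are finitely many assets, so one
    \<open>e\<close> serves all.\<close>
  proof (cases "S l = S i")
    case True
    then have "V l \<le> V i" using tie by (simp add: S_def V_def)
    then have "S l + e * V l \<le> S i + e * V i" if "0 < e" for e
      using True that by (simp add: mult_left_mono)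
    then show ?thesis unfolding eventually_at_right_field by (auto intro!: exI[of _ 1])
  next
    case False
    then have lt: "S l < S i" using max[of l] by (simp add: S_def)
    have "((\<lambda>e. (S i + e * V i) - (S l + e * V l)) \<longlongrightarrow> (S i + 0 * V i) - (S l + 0 * V l)) (at_right 0)"
      by (intro tendsto_intros)
    then have "\<forall>\<^sub>F e in at_right 0. 0 < (S i + e * V i) - (S l + e * V l)"
      by (rule order_tendstoD) (use lt in simp)
    then show ?thesis by eventually_elim simp
  qed
  then have "\<forall>\<^sub>F e in at_right 0. \<forall>l. S l + e * V l \<le> S i + e * V i" by (rule eventually_all_finite)
  moreover have "\<forall>\<^sub>F e in at_right 0. (0::real) < e" by (rule eventually_at_right_less)
  ultimately have "\<forall>\<^sub>F e in at_right 0. 0 < e \<and> (\<forall>l. S l + e * V l \<le> S i + e * V i)" by eventually_elim simp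
  then obtain e where e: "0 < e" "\<And>l. S l + e * V l \<le> S i + e * V i"
    using eventually_happens'[OF trivial_limit_at_right_real] by blast
  define w' where "w' x = w x * (1 + e * v x)" for x
  have w': "0 < w' x" if "x \<in> X" for x using w[OF that] v(1)[of x] e(1) by (simp add: w'_def add_pos_nonneg)
  have S': "(\<Sum>x\<in>X. w' x * x $ l) = S l + e * V l" for l
    by (simp add: w'_def S_def V_def sum_distrib_left sum.distrib[symmetric] algebra_simps)
  have Spos: "0 < (\<Sum>x\<in>X. u x * x $ i)" if "\<And>x. x \<in> X \<Longrightarrow> 0 < u x" for u
    using that xy(1,3) nonneg by (intro sum_pos2[OF finite_X xy(1)]) (auto simp: less_imp_le)
  have ex: "\<exists>P\<in>prob_on X. \<forall>x\<in>X. pmf P x = u x * x $ i / (\<Sum>x\<in>X. u x * x $ i)"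
    if u: "\<And>x. x \<in> X \<Longrightarrow> 0 < u x" for u
  proof -
    define T where "T = (\<Sum>x\<in>X. u x * x $ i)"
    have T: "0 < T" unfolding T_def by (rule Spos[of u, OF u])
    have ge: "0 \<le> u x * x $ i / T" if "x \<in> X" for x
      using u[OF that] nonneg[OF that] T by (simp add: less_imp_le)
    have sum: "(\<Sum>x\<in>X. u x * x $ i / T) = 1"
      using T by (simp add: sum_divide_distrib[symmetric]) (simp add: T_def)
    show ?thesis
      unfolding T_def[symmetric] by (rule pmf_of_weights[OF finite_X ge sum]) auto
  qed
  obtain P where P: "P \<in> prob_on X" "\<And>x. x \<in> X \<Longrightarrow> pmf P x = w x * x $ i / (\<Sum>x\<in>X. w x * x $ i)"
    using ex[of w, OF w] by blast
  obtain Q where Q: "Q \<in> prob_on X" "\<And>x. x \<in> X \<Longrightarrow> pmf Q x = w' x * x $ i / (\<Sum>x\<in>X. w' x * x $ i)"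
    using ex[of w', OF w'] by blast
  have "axis i 1 \<in> optimal_portfolios P" by (rule axis_optimal[OF P(1) w max Spos[of w, OF w] P(2)])
  moreover have "axis i 1 \<in> optimal_portfolios Q"
    by (rule axis_optimal[OF Q(1) w' _ Spos[of w', OF w'] Q(2)]) (simp_all add: S' e(2))
  ultimately have PQ: "P = Q" using sep P(1) Q(1) regret_eq_0 by blast
  \<comment> \<open>Equality of the two distributions makes the perturbation factor constant on the
    states where asset \<open>i\<close> pays, and \<open>v\<close> is injective.\<close>
  have "1 + e * v z = (\<Sum>x\<in>X. w' x * x $ i) / (\<Sum>x\<in>X. w x * x $ i)" if "z \<in> X" "0 < z $ i" for z
  proof -
    have "w z * z $ i / (\<Sum>x\<in>X. w x * x $ i) = w z * (1 + e * v z) * z $ i / (\<Sum>x\<in>X. w' x * x $ i)"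
      using P(2)[OF that(1)] Q(2)[OF that(1)] PQ by (simp add: w'_def)
    then have "(w z * z $ i) * (1 / (\<Sum>x\<in>X. w x * x $ i)) = (w z * z $ i) * ((1 + e * v z) / (\<Sum>x\<in>X. w' x * x $ i))"
      by (simp add: mult_ac)
    then have "1 / (\<Sum>x\<in>X. w x * x $ i) = (1 + e * v z) / (\<Sum>x\<in>X. w' x * x $ i)"
      using w[OF that(1)] that(2) by (subst (asm) mult_left_cancel) auto
    then show ?thesis using Spos[of w, OF w] Spos[of w', OF w'] by (simp add: divide_simps)
  qed
  then have "1 + e * v x = 1 + e * v y" using xy by simp
  then have "v x = v y" using e(1) by simp
  then show ?thesis using v(2) xy by (simp add: inj_on_def)
qed

section \<open>Returns relative to the best asset\<close>

definition best :: "real ^ 'm \<Rightarrow> real" where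
  "best x = Max (range (($) x))"

lemma le_best: "x $ i \<le> best x"
  by (simp add: best_def)

lemma best_attained: obtains i where "x $ i = best x"
proof -
  have "best x \<in> range (($) x)" unfolding best_def by (rule Max_in) auto
  then show ?thesis using that by auto
qed

lemma best_pos:
  assumes x: "x \<in> X"
  shows "0 < best x"
proof (rule ccontr)
  assume "\<not> 0 < best x"
  then have x0: "x $ i = 0" for i using nonneg[OF x, of i] le_best[of x i] by linarith
  obtain b where "b \<in> optimal_portfolios (return_pmf x)"
    using optimal_portfolios_nonempty[OF return_pmf_in_prob_on[OF x]] .
  then have "0 < x \<bullet> b" using inner_optimal_pos[OF return_pmf_in_prob_on[OF x]] by simp
  then show False using x0 by (simp add: inner_vec_def)
qed

text \<open>With weights \<open>1 / best x\<close>, take an asset with the largest total. It pays in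
  at most one state by \<open>dominant_asset_single_state\<close>, so its total is at most one, and
  it bounds all others.\<close>

lemma separation_imp_relative_sum_le_1:
  assumes sep: "\<And>P Q. \<lbrakk>P \<in> prob_on X; Q \<in> prob_on X; regret P Q = 0\<rbrakk> \<Longrightarrow> P = Q"
  shows "(\<Sum>x\<in>X. x $ l / best x) \<le> 1"
proof -
  obtain v :: "real ^ 'm \<Rightarrow> nat" where v: "inj_on v X"
    using finite_imp_inj_to_nat_seg[OF finite_X] by blast
  define S V where "S l = (\<Sum>x\<in>X. 1 / best x * x $ l)" and "V l = (\<Sum>x\<in>X. 1 / best x * real (v x) * x $ l)" for l
  define A where "A = {l. S l = Max (range S)}"
  have "Max (range S) \<in> range S" by (rule Max_in) auto
  then obtain l\<^sub>0 where "Max (range S) = S l\<^sub>0" by (rule imageE)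
  then have "l\<^sub>0 \<in> A" by (simp add: A_def)
  then have "A \<noteq> {}" by blast
  then have "Max (V ` A) \<in> V ` A" by (intro Max_in) auto
  \<comment> \<open>Among the assets of maximal \<open>S\<close>, one of maximal \<open>V\<close> is
    chosen, so that it also wins ties after the perturbation.\<close>
  then obtain i where i: "i \<in> A" "V i = Max (V ` A)" by auto
  have S_max: "S l \<le> S i" for l using i(1) by (simp add: A_def)
  have V_max: "V l \<le> V i" if "S l = S i" for l using that i by (auto simp: A_def)
  have single: "x = y" if "x \<in> X" "y \<in> X" "0 < x $ i" "0 < y $ i" for x y
    using S_max V_max v that
    by (intro dominant_asset_single_state[OF sep, of "\<lambda>x. 1 / best x" "\<lambda>x. real (v x)" i x y])
      (auto simp: S_def V_def best_pos inj_on_def)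
  have "S i \<le> 1"
  proof (cases "\<exists>x\<in>X. 0 < x $ i")
    case True
    then obtain x where x: "x \<in> X" "0 < x $ i" by blast
    have "y $ i = 0" if "y \<in> X - {x}" for y
      using single[of x y] x that nonneg[of y i] by (auto simp: less_le)
    then have "S i = 1 / best x * x $ i" unfolding S_def using finite_X x(1) by (simp add: sum.remove)
    also have "\<dots> \<le> 1" using best_pos[OF x(1)] le_best[of x i] by simp
    finally show ?thesis .
  next
    case False
    then have "x $ i = 0" if "x \<in> X" for x using that nonneg[OF that, of i] by (auto simp: less_le)
    then show ?thesis by (simp add: S_def)
  qed
  then show ?thesis using S_max[of l] by (simp add: S_def)
qed

text \<open>Gibbs' inequality: in terms of \<open>x \<bullet> b / best x\<close>, which sums to at most one, the growth rate is a
  cross entropy.\<close>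

lemma inner_optimal_eq_pmf:
  assumes rel: "\<And>l. (\<Sum>x\<in>X. x $ l / best x) \<le> 1"
    and Q: "Q \<in> prob_on X" and b: "b \<in> optimal_portfolios Q" and x: "x \<in> X"
  shows "x \<bullet> b = best x * pmf Q x"
proof -
  note bp = optimal_in_portfolios[OF b]
  define q where "q y = y \<bullet> b / best y" for y
  have q_nonneg: "0 \<le> q y" if "y \<in> X" for y
    using inner_nonneg[OF that bp] best_pos[OF that] by (simp add: q_def)
  have "(\<Sum>y\<in>X. q y) = (\<Sum>l\<in>UNIV. b $ l * (\<Sum>y\<in>X. y $ l / best y))"
    unfolding q_def inner_vec_def sum_distrib_left sum_divide_distrib by (subst sum.swap) (simp add: mult_ac)
  also have "\<dots> \<le> (\<Sum>l\<in>UNIV. b $ l * 1)"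
    using bp by (intro sum_mono mult_left_mono rel) (simp add: portfolios_def)
  also have "\<dots> = 1" using bp by (simp add: portfolios_def)
  finally have q_sum: "(\<Sum>y\<in>X. q y) \<le> 1" .
  have "\<forall>y. \<exists>i. y $ i = best y" using best_attained by blast
  then obtain h where h: "y $ h y = best y" for y by metis
  \<comment> \<open>Proportional betting: the mass of \<open>y\<close> is staked on an asset that is
    best in \<open>y\<close>. Other stakes may also pay in \<open>y\<close>, hence only an
    inequality in \<open>c_ge\<close>.\<close>
  define c where "c = (\<Sum>y\<in>X. pmf Q y *\<^sub>R axis (h y) (1::real))"
  have cp: "c \<in> portfolios" unfolding c_def
    by (intro convex_sum[OF finite_X convex_portfolios] axis_in_portfolios sum_pmf_prob_on[OF finite_X Q]) simp
  have c_ge: "pmf Q y * best y \<le> y \<bullet> c" if y: "y \<in> X" for y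
  proof -
    have "pmf Q y * y $ h y \<le> (\<Sum>z\<in>X. pmf Q z * y $ h z)"
      using nonneg[OF y] by (intro member_le_sum[OF y _ finite_X]) auto
    then show ?thesis by (simp add: h c_def inner_sum_right inner_axis)
  qed
  have pos: "0 < pmf Q y" "0 < best y" "0 < y \<bullet> b" "0 < q y" if "y \<in> set_pmf Q" for y
    using pmf_positive[OF that] best_pos[OF in_X[OF Q that]] inner_optimal_pos[OF Q b that] by (auto simp: q_def)
  have cpos: "0 < y \<bullet> c" if "y \<in> set_pmf Q" for y
    using c_ge[OF in_X[OF Q that]] mult_pos_pos[OF pos(1,2)[OF that]] by linarith
  have "log_growth c Q \<le> log_growth b Q"
    using log_growth_le_max[OF Q cp cpos] log_growth_optimal[OF Q b] by simp
  moreover have "(\<Sum>y\<in>set_pmf Q. pmf Q y * ln (pmf Q y * best y)) \<le> log_growth c Q"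
    unfolding log_growth_support[OF Q]
  proof (intro sum_mono mult_left_mono)
    fix y assume y: "y \<in> set_pmf Q"
    show "ln (pmf Q y * best y) \<le> ln (y \<bullet> c)"
      using c_ge[OF in_X[OF Q y]] mult_pos_pos[OF pos(1,2)[OF y]] by (intro ln_mono) auto
  qed simp
  ultimately have ge: "0 \<le> (\<Sum>y\<in>set_pmf Q. pmf Q y * (ln (y \<bullet> b) - ln (pmf Q y * best y)))"
    by (simp add: log_growth_support[OF Q] right_diff_distrib sum_subtractf)
  have fin: "finite (set_pmf Q)" and subX: "set_pmf Q \<subseteq> X"
    using Q finite_X finite_subset by (auto simp: prob_on_def)
  have Qsum: "(\<Sum>y\<in>set_pmf Q. pmf Q y) = 1" using fin by (intro sum_pmf_eq_1) auto
  \<comment> \<open>The nonnegative defect in Gibbs' inequality. Optimality of \<open>b\<close>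
    against \<open>c\<close> makes its sum nonpositive, so each term vanishes.\<close>
  define g where "g y = q y - pmf Q y - pmf Q y * (ln (y \<bullet> b) - ln (pmf Q y * best y))" for y
  have g_eq: "g y = pmf Q y * (q y / pmf Q y - 1 - ln (q y / pmf Q y))" if "y \<in> set_pmf Q" for y
    using pos[OF that] by (simp add: g_def ln_div ln_mult q_def right_diff_distrib algebra_simps)
  have g_nonneg: "0 \<le> g y" if "y \<in> set_pmf Q" for y
    unfolding g_eq[OF that] using pos[OF that] ln_le_minus_one[of "q y / pmf Q y"] by simp
  have "(\<Sum>y\<in>set_pmf Q. q y) \<le> (\<Sum>y\<in>X. q y)" using finite_X subX q_nonneg by (intro sum_mono2) auto
  then have "(\<Sum>y\<in>set_pmf Q. g y) \<le> 0"
    using ge Qsum q_sum by (simp add: g_def sum_subtractf)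
  then have "(\<Sum>y\<in>set_pmf Q. g y) = 0" using g_nonneg by (intro antisym sum_nonneg)
  then have g0: "g y = 0" if "y \<in> set_pmf Q" for y
    using sum_nonneg_eq_0_iff[OF fin, of g] g_nonneg that by auto
  have q_eq: "q y = pmf Q y" if y: "y \<in> set_pmf Q" for y
  proof -
    have "ln (q y / pmf Q y) = q y / pmf Q y - 1" using g0[OF y] g_eq[OF y] pos[OF y] by simp
    then have "q y / pmf Q y = 1" using pos[OF y] by (intro ln_eq_minus_one) auto
    then show ?thesis using pos[OF y] by simp
  qed
  have "q x = pmf Q x"
  proof (cases "x \<in> set_pmf Q")
    case False
    \<comment> \<open>On the support \<open>q\<close> already has total one, so nothing is left for
      \<open>x\<close>.\<close>
    have "(\<Sum>y\<in>set_pmf Q. q y) + q x \<le> (\<Sum>y\<in>X. q y)"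
    proof -
      have "(\<Sum>y\<in>insert x (set_pmf Q). q y) \<le> (\<Sum>y\<in>X. q y)"
        using finite_X subX q_nonneg x by (intro sum_mono2) auto
      then show ?thesis using fin False by simp
    qed
    moreover have "(\<Sum>y\<in>set_pmf Q. q y) = 1" using q_eq Qsum by simp
    ultimately have "q x = 0" using q_sum q_nonneg[OF x] by simp
    then show ?thesis using False by (simp add: set_pmf_iff)
  qed (rule q_eq)
  then show ?thesis using best_pos[OF x] by (simp add: q_def field_simps)
qed

text \<open>Optimal returns are \<open>best x\<close> times the mass, and the factor
  \<open>best x\<close> cancels in the difference of logarithms. A state of \<open>P\<close> outside
  the support of \<open>Q\<close> has return zero under every portfolio optimal for
  \<open>Q\<close>.\<close>

lemma regret_eq_kl:
  assumes rel: "\<And>l. (\<Sum>x\<in>X. x $ l / best x) \<le> 1"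
    and P: "P \<in> prob_on X" and Q: "Q \<in> prob_on X"
  shows "regret P Q = (if set_pmf P \<subseteq> set_pmf Q
    then ereal (\<Sum>x\<in>X. pmf P x * ln (pmf P x / pmf Q x)) else \<infinity>)"
proof (cases "set_pmf P \<subseteq> set_pmf Q")
  case True
  obtain b where b: "b \<in> optimal_portfolios Q" using optimal_portfolios_nonempty[OF Q] .
  obtain c where c: "c \<in> optimal_portfolios P" using optimal_portfolios_nonempty[OF P] .
  have "max_log_growth P - log_growth b P = (\<Sum>x\<in>X. pmf P x * (ln (best x * pmf P x) - ln (best x * pmf Q x)))"
    unfolding log_growth_optimal[OF P c, symmetric] log_growth_def
    by (simp add: inner_optimal_eq_pmf[OF rel P c] inner_optimal_eq_pmf[OF rel Q b] right_diff_distrib sum_subtractf)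
  also have "\<dots> = (\<Sum>x\<in>X. pmf P x * ln (pmf P x / pmf Q x))"
  proof (intro sum.cong refl)
    fix x assume x: "x \<in> X"
    show "pmf P x * (ln (best x * pmf P x) - ln (best x * pmf Q x)) = pmf P x * ln (pmf P x / pmf Q x)"
    proof (cases "x \<in> set_pmf P")
      case pos: True
      then have "0 < pmf P x" "0 < pmf Q x" using True by (auto intro: pmf_positive)
      then show ?thesis using best_pos[OF x] by (simp add: ln_mult ln_div)
    qed (simp add: set_pmf_iff)
  qed
  finally show ?thesis using regret_dominated[OF P Q True b] True by simp
next
  case False
  then obtain x where x: "x \<in> set_pmf P" "x \<notin> set_pmf Q" by blast
  have "max_growth P - growth b P = \<infinity>" if b: "b \<in> optimal_portfolios Q" for b
  proof -
    have "x \<bullet> b = 0" using inner_optimal_eq_pmf[OF rel Q b in_X[OF P x(1)]] x(2) by (simp add: set_pmf_iff)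
    from P optimal_in_portfolios[OF b] have "growth b P = - \<infinity>"
      by (rule growth_cases) (use x(1) \<open>x \<bullet> b = 0\<close> in force)+
    then show ?thesis using max_growth_eq[OF P] by simp
  qed
  then show ?thesis unfolding regret_def using False by (simp add: top_ereal_def[symmetric] INF_eqI)
qed

lemma regret_data_processing:
  assumes rel: "\<And>l. (\<Sum>x\<in>X. x $ l / best x) \<le> 1" and \<Phi>: "affine_self_map X \<Phi>"
    and P: "P \<in> prob_on X" and Q: "Q \<in> prob_on X"
  shows "regret (\<Phi> P) (\<Phi> Q) \<le> regret P Q"
proof (cases "set_pmf P \<subseteq> set_pmf Q")
  case True
  define K where "K x = \<Phi> (return_pmf x)" for x
  have K: "K x \<in> prob_on X" if "x \<in> X" for x
    using \<Phi> return_pmf_in_prob_on[OF that] by (simp add: affine_self_map_def K_def)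
  have \<Phi>K: "\<Phi> P = bind_pmf P K" "\<Phi> Q = bind_pmf Q K"
    using affine_self_map_kernel[OF \<Phi> finite_X] P Q by (simp_all add: K_def[abs_def])
  have in_prob: "\<Phi> P \<in> prob_on X" "\<Phi> Q \<in> prob_on X" using \<Phi> P Q by (auto simp: affine_self_map_def)
  have "set_pmf (\<Phi> P) \<subseteq> set_pmf (\<Phi> Q)" using True by (auto simp: \<Phi>K)
  then show ?thesis
    using True kl_data_processing[OF finite_X P Q True K]
    by (simp add: regret_eq_kl[OF rel] in_prob P Q) (simp add: \<Phi>K)
next
  case False
  then show ?thesis by (simp add: regret_eq_kl[OF rel P Q])
qed

lemma separation_imp_sufficiency:
  assumes sep: "\<And>P Q. \<lbrakk>P \<in> prob_on X; Q \<in> prob_on X; regret P Q = 0\<rbrakk> \<Longrightarrow> P = Q"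
  shows "iso_sufficiency X regret"
  unfolding iso_sufficiency_def sufficient_for_def
proof (intro ballI allI impI, elim conjE exE)
  fix P Q \<Phi> \<Psi>
  assume P: "P \<in> prob_on X" and Q: "Q \<in> prob_on X" and \<Phi>: "affine_self_map X \<Phi>"
    and \<Psi>: "affine_self_map X \<Psi>" "\<Psi> (\<Phi> P) = P" "\<Psi> (\<Phi> Q) = Q"
  have rel: "(\<Sum>x\<in>X. x $ l / best x) \<le> 1" for l
    by (rule separation_imp_relative_sum_le_1[OF sep])
  note dpi = regret_data_processing[OF rel]
  have "\<Phi> P \<in> prob_on X" "\<Phi> Q \<in> prob_on X" using \<Phi> P Q by (auto simp: affine_self_map_def)
  then have "regret P Q \<le> regret (\<Phi> P) (\<Phi> Q)" using dpi[OF \<Psi>(1), of "\<Phi> P" "\<Phi> Q"] \<Psi> by simp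
  then show "regret (\<Phi> P) (\<Phi> Q) = regret P Q" using dpi[OF \<Phi> P Q] by (intro antisym) auto
qed

end

text \<open>\<open>nontrivial\<close> excludes markets such as one with an asset that is best in
  every state. There the regret is identically zero, so sufficiency holds trivially while separation
  fails.\<close>

theorem corollary20:
  fixes X :: "(real ^ 'm) set"
  assumes finite_X: "finite X"
    and nonneg: "\<And>x i. x \<in> X \<Longrightarrow> 0 \<le> x $ i"
    and three: "3 \<le> card X"
    and finite_max: "\<And>P. P \<in> prob_on X \<Longrightarrow> \<bar>max_growth P\<bar> \<noteq> \<infinity>"
    and nontrivial: "\<exists>P\<in>prob_on X. \<exists>Q\<in>prob_on X. regret P Q \<noteq> 0"
  shows "iso_sufficiency X regret \<longleftrightarrow>
    (\<forall>P\<in>prob_on X. \<forall>Q\<in>prob_on X. regret P Q = 0 \<longrightarrow> P = Q)"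
proof -
  interpret market X using finite_X nonneg finite_max by unfold_locales
  show ?thesis
    using sufficiency_imp_separation[OF _ three] separation_imp_sufficiency nontrivial by blast
qed

end
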